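(* For every integer $N \geq 1$, there exist an integer $T \geq 1$ and a Baire generic subset of $\mathbb{R}^T$ (that is, a subset containing a dense $G_\delta$ set) all of whose elements $V$ are $N$-malleable.
   Context: For $t\in\mathbb{R}$ let $A^{(t)}=\begin{pmatrix} t & -1\\ 1 & 0\end{pmatrix}\in\mathrm{SL}(2,\mathbb{R})$. For integers $N,T\ge 1$, let $\Phi^{N,T}:\mathbb{R}^N\times\mathbb{R}^T\to\mathrm{SL}(2,\mathbb{R})^N$ be given by $\Phi^{N,T}=(\Phi^{N,T}_j)_{j=1}^N$, $\Phi^{N,T}_j(E,V)=A^{(E_j-V_T)}\cdots A^{(E_j-V_1)}$. Let $\mathcal{C}^N\subset\mathbb{R}^N$ be the set of all $E\in\mathbb{R}^N$ with $E_i=E_j$ for some $1\le i<j\le N$. A vector $V^*\in\mathbb{R}^T$ is called $N$-malleable if for every $E\in\mathbb{R}^N\setminus\mathcal{C}^N$, the map $V\mapsto\Phi^{N,T}(E,V)$ from $\mathbb{R}^T$ to $\mathrm{SL}(2,\mathbb{R})^N$ is open at $V^*$, i.e., the image of every neighborhood of $V^*$ in $\mathbb{R}^T$ contains a neighborhood of $\Phi^{N,T}(E,V^* )$ in $\mathrm{SL}(2,\mathbb{R})^N$. *)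

theory Defs
  imports "HOL-Analysis.Analysis"
begin

text \<open>
  Since the dimension \<open>T\<close> is existentially quantified, \<open>\<real>\<^sup>n\<close> is the library's
  \<^term>\<open>Euclidean_space n\<close>: sequences \<open>nat \<Rightarrow> real\<close> vanishing at all indices \<open>\<ge> n\<close>.
  Coordinates are therefore numbered \<open>0, \<dots>, n - 1\<close>, i.e. \<open>V_(k+1)\<close> is \<open>V k\<close>.
\<close>

definition SL2 :: "(real^2^2) set" where
  "SL2 = {M. det M = 1}"

definition SL2_power :: "nat \<Rightarrow> (nat \<Rightarrow> real^2^2) topology" where
  "SL2_power N = product_topology (\<lambda>_. top_of_set SL2) {..<N}"

definition Amat :: "real \<Rightarrow> real^2^2" where
  "Amat t = vector [vector [t, -1], vector [1, 0]]"

text \<open>\<open>transfer T e V = Amat (e - V (T-1)) ** \<dots> ** Amat (e - V 0)\<close>\<close>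

primrec transfer :: "nat \<Rightarrow> real \<Rightarrow> (nat \<Rightarrow> real) \<Rightarrow> real^2^2" where
  "transfer 0 e V = mat 1"
| "transfer (Suc k) e V = Amat (e - V k) ** transfer k e V"

definition Phi :: "nat \<Rightarrow> nat \<Rightarrow> (nat \<Rightarrow> real) \<Rightarrow> (nat \<Rightarrow> real) \<Rightarrow> (nat \<Rightarrow> real^2^2)" where
  "Phi N T E V = (\<lambda>j\<in>{..<N}. transfer T (E j) V)"

definition coll :: "nat \<Rightarrow> (nat \<Rightarrow> real) set" where
  "coll N = {E \<in> topspace (Euclidean_space N). \<exists>i j. i < j \<and> j < N \<and> E i = E j}"

definition open_map_at :: "'a topology \<Rightarrow> 'b topology \<Rightarrow> ('a \<Rightarrow> 'b) \<Rightarrow> 'a \<Rightarrow> bool" where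
  "open_map_at X Y f x \<longleftrightarrow>
     (\<forall>U \<subseteq> topspace X. x \<in> X interior_of U \<longrightarrow> f x \<in> Y interior_of (f ` U))"

definition malleable :: "nat \<Rightarrow> nat \<Rightarrow> (nat \<Rightarrow> real) \<Rightarrow> bool" where
  "malleable N T V \<longleftrightarrow> V \<in> topspace (Euclidean_space T) \<and>
     (\<forall>E \<in> topspace (Euclidean_space N) - coll N.
        open_map_at (Euclidean_space T) (SL2_power N) (Phi N T E) V)"

definition baire_generic :: "'a topology \<Rightarrow> 'a set \<Rightarrow> bool" where
  "baire_generic X S \<longleftrightarrow> S \<subseteq> topspace X \<and>
     (\<exists>G. G \<subseteq> S \<and> gdelta_in X G \<and> X closure_of G = topspace X)"

end

theory Submission
  imports Defs "HOL-Library.Function_Algebras" "HOL-Homology.Invariance_of_Domain"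
begin

text \<open>
  Write \<open>(a\<^sub>j\<^sub>k, b\<^sub>j\<^sub>k)\<close> for the first row of the \<open>k\<close>-step transfer matrix at energy \<open>E j\<close>. The map
  \<open>V \<mapsto> Phi N T E V\<close> is a submersion into \<open>SL(2)\<^sup>N\<close> as soon as no nonzero tuple of binary quadratic forms
  \<open>Q\<^sub>j\<close> satisfies \<open>\<Sum>j. Q\<^sub>j (a\<^sub>j\<^sub>k, b\<^sub>j\<^sub>k) = 0\<close> for all \<open>k < T\<close>.

  For fixed distinct energies, if these sums vanish for every choice of the next \<open>2N + 3\<close> potential
  values, comparing coefficients shows that all moments \<open>\<Sum>j. (E j)\<^sup>n x\<^sub>j\<close> of the coefficients of the
  forms vanish, hence so do the forms. Choosing potentials greedily gives a window length \<open>L\<close>,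
  depending on \<open>N\<close> only, and for every \<open>E\<close> a nonzero polynomial \<open>p\<^sub>E\<close> on \<open>\<real>\<^sup>L\<close> such that \<open>p\<^sub>E V \<noteq> 0\<close> makes the
  map a submersion at \<open>V\<close>.

  The polynomials \<open>p\<^sub>E\<close> all lie in one finite-dimensional space, of dimension \<open>M\<close> say. For generic
  \<open>V\<^sup>1, \<dots>, V\<^sup>M\<close> in \<open>\<real>\<^sup>L\<close> no nonzero element of this space vanishes at all \<open>V\<^sup>i\<close>, so for every \<open>E\<close> one of the
  \<open>M\<close> blocks of \<open>V = (V\<^sup>1, \<dots>, V\<^sup>M)\<close> already makes the map a submersion. This handles all \<open>E\<close> at once.
\<close>

section \<open>Nondegenerate families of rows\<close>

text \<open>For finite \<open>I\<close> this says that the rows \<open>w k\<close> span all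
  functions on \<open>I\<close>: the matrix has full column rank, phrased through linear relations
  among its columns.\<close>

definition nondeg :: "'k set \<Rightarrow> 'i set \<Rightarrow> ('k \<Rightarrow> 'i \<Rightarrow> real) \<Rightarrow> bool" where
  "nondeg K I w \<longleftrightarrow> (\<forall>q. (\<forall>k\<in>K. (\<Sum>i\<in>I. q i * w k i) = 0) \<longrightarrow> (\<forall>i\<in>I. q i = 0))"

lemma nondegD:
  "nondeg K I w \<Longrightarrow> (\<And>k. k \<in> K \<Longrightarrow> (\<Sum>i\<in>I. q i * w k i) = 0) \<Longrightarrow> i \<in> I \<Longrightarrow> q i = 0"
  by (auto simp: nondeg_def)

lemma nondeg_insert_pivot:
  assumes "nondeg K (insert i0 I) w" "finite I" "i0 \<notin> I"
  obtains k0 where "k0 \<in> K" "w k0 i0 \<noteq> 0"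
proof -
  have "\<exists>k0\<in>K. w k0 i0 \<noteq> 0"
  proof (rule ccontr)
    assume *: "\<not> ?thesis"
    have "(\<Sum>i\<in>insert i0 I. (if i = i0 then 1 else 0) * w k i) = w k i0" for k
      using assms by (simp add: sum.neutral)
    with * assms(1) show False
      by (auto simp: nondeg_def dest!: spec[of _ "\<lambda>i. if i = i0 then 1 else 0 :: real"])
  qed
  then show ?thesis using that by blast
qed

text \<open>One step of Gaussian elimination with pivot \<open>w k0 i0\<close>. It is free of
  divisions, so polynomial entries stay polynomial. A relation among the reduced columns lifts to
  the original ones, with row \<open>k0\<close> dictating the coefficient of column
  \<open>i0\<close>.\<close>

lemma nondeg_eliminate:
  fixes w :: "'k \<Rightarrow> 'i \<Rightarrow> real"
  assumes nd: "nondeg K (insert i0 I) w" and I: "finite I" "i0 \<notin> I" and k0: "w k0 i0 \<noteq> 0"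
    "k0 \<in> K"
  shows "nondeg K I (\<lambda>k i. w k0 i0 * w k i - w k i0 * w k0 i)"
  unfolding nondeg_def
proof (intro allI impI)
  fix q assume q: "\<forall>k\<in>K. (\<Sum>i\<in>I. q i * (w k0 i0 * w k i - w k i0 * w k0 i)) = 0"
  define q' where "q' i = (if i = i0 then - (\<Sum>i\<in>I. q i * w k0 i) else w k0 i0 * q i)" for i
  have "(\<Sum>i\<in>insert i0 I. q' i * w k i) = 0" if "k \<in> K" for k
  proof -
    have "(\<Sum>i\<in>I. q' i * w k i) = (\<Sum>i\<in>I. w k0 i0 * q i * w k i)"
      using I by (intro sum.cong) (auto simp: q'_def)
    then have "(\<Sum>i\<in>insert i0 I. q' i * w k i)
        = (\<Sum>i\<in>I. w k0 i0 * q i * w k i) - (\<Sum>i\<in>I. q i * w k0 i) * w k i0"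
      using I by (simp add: q'_def)
    also have "\<dots> = (\<Sum>i\<in>I. q i * (w k0 i0 * w k i - w k i0 * w k0 i))"
      by (simp add: sum_distrib_left sum_distrib_right algebra_simps flip: sum_subtractf)
    finally show ?thesis using q that by simp
  qed
  then have "\<forall>i\<in>I. q' i = 0" using nondegD[OF nd] by (metis insertCI)
  then show "\<forall>i\<in>I. q i = 0" using I k0 by (auto simp: q'_def split: if_splits)
qed

text \<open>The converse elimination step lets a nonzero pivot, together with nondegeneracy of the
  reduced family, certify nondegeneracy of the original family.\<close>

lemma nondeg_uneliminate:
  fixes w :: "'k \<Rightarrow> 'i \<Rightarrow> real"
  assumes nd: "nondeg K I (\<lambda>k i. w k0 i0 * w k i - w k i0 * w k0 i)"
    and I: "finite I" "i0 \<notin> I" and k0: "w k0 i0 \<noteq> 0" "k0 \<in> K"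
  shows "nondeg K (insert i0 I) w"
  unfolding nondeg_def
proof (intro allI impI)
  fix q assume q: "\<forall>k\<in>K. (\<Sum>i\<in>insert i0 I. q i * w k i) = 0"
  have r: "(\<Sum>i\<in>I. q i * w k i) = - q i0 * w k i0" if "k \<in> K" for k
    using q that I by (simp add: eq_neg_iff_add_eq_0 add.commute)
  have "(\<Sum>i\<in>I. q i * (w k0 i0 * w k i - w k i0 * w k0 i)) = 0" if "k \<in> K" for k
  proof -
    have "(\<Sum>i\<in>I. q i * (w k0 i0 * w k i - w k i0 * w k0 i))
        = w k0 i0 * (\<Sum>i\<in>I. q i * w k i) - w k i0 * (\<Sum>i\<in>I. q i * w k0 i)"
      by (simp add: sum_distrib_left algebra_simps flip: sum_subtractf)
    then show ?thesis using r[OF that] r[OF k0(2)] by simp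
  qed
  then have z: "\<forall>i\<in>I. q i = 0" using nondegD[OF nd] by metis
  then have "(\<Sum>i\<in>I. q i * w k0 i) = 0" by (intro sum.neutral) auto
  then have "q i0 = 0" using r[OF k0(2)] k0 by simp
  with z show "\<forall>i\<in>insert i0 I. q i = 0" by auto
qed

lemma nondeg_spans:
  fixes w :: "'k \<Rightarrow> 'i \<Rightarrow> real"
  assumes "finite I" "finite K" "nondeg K I w"
  shows "\<exists>c. \<forall>i\<in>I. (\<Sum>k\<in>K. c k * w k i) = t i"
  using assms(1,3)
proof (induction I arbitrary: w t rule: finite_induct)
  case empty
  then show ?case by auto
next
  case (insert i0 I)
  obtain k0 where k0: "k0 \<in> K" "w k0 i0 \<noteq> 0"
    using nondeg_insert_pivot insert by metis
  let ?a = "w k0 i0"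
  obtain c' where c': "\<And>i. i \<in> I \<Longrightarrow>
      (\<Sum>k\<in>K. c' k * (?a * w k i - w k i0 * w k0 i)) = ?a * t i - t i0 * w k0 i"
    using insert.IH[OF nondeg_eliminate[OF insert.prems insert.hyps k0(2,1)],
        of "\<lambda>i. ?a * t i - t i0 * w k0 i"] by blast
  \<comment> \<open>The reduced row of \<open>k0\<close> is zero, so its coefficient is still free.
    It is corrected to give the prescribed value in column \<open>i0\<close>; the target in the
    induction hypothesis already accounts for the effect on the other columns.\<close>
  define s where "s = (\<Sum>k\<in>K. c' k * w k i0)"
  define c where "c k = c' k + (if k = k0 then (t i0 - s) / ?a else 0)" for k
  have c: "(\<Sum>k\<in>K. c k * w k i) = (\<Sum>k\<in>K. c' k * w k i) + (t i0 - s) / ?a * w k0 i" for i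
  proof -
    have "(\<Sum>k\<in>K. c k * w k i) = (\<Sum>k\<in>K. c' k * w k i)
        + (\<Sum>k\<in>K. if k = k0 then (t i0 - s) / ?a * w k i else 0)"
      unfolding c_def by (subst sum.distrib[symmetric], rule sum.cong) (auto simp: algebra_simps)
    then show ?thesis using assms(2) k0 by simp
  qed
  have "(\<Sum>k\<in>K. c k * w k i) = t i" if "i \<in> I" for i
  proof -
    have "(\<Sum>k\<in>K. c' k * (?a * w k i - w k i0 * w k0 i))
        = ?a * (\<Sum>k\<in>K. c' k * w k i) - s * w k0 i"
      by (simp add: s_def sum_distrib_left sum_distrib_right algebra_simps flip: sum_subtractf)
    then show ?thesis using c'[OF that] k0 by (simp add: c field_simps)
  qed
  moreover have "(\<Sum>k\<in>K. c k * w k i0) = t i0" using k0 by (simp add: c flip: s_def)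
  ultimately show ?case by auto
qed

lemma nondeg_right_inverse:
  fixes w :: "'k \<Rightarrow> 'i \<Rightarrow> real"
  assumes "finite I" "finite K" "nondeg K I w"
  obtains R where "\<And>i j. i \<in> I \<Longrightarrow> (\<Sum>k\<in>K. R k j * w k i) = (if i = j then 1 else 0)"
proof -
  have "\<forall>j. \<exists>c. \<forall>i\<in>I. (\<Sum>k\<in>K. c k * w k i) = (if i = j then 1 else 0)"
    by (intro allI nondeg_spans[OF assms])
  then obtain c where "\<forall>j. \<forall>i\<in>I. (\<Sum>k\<in>K. c j k * w k i) = (if i = j then 1 else 0)"
    by metis
  then show ?thesis using that[of "\<lambda>k j. c j k"] by auto
qed

text \<open>Block \<open>n\<close> consists of the coordinates from \<open>n * L\<close> up to
  \<open>Suc n * L - 1\<close>. By \<open>loc\<close>, later blocks do not disturb earlier rows; by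
  \<open>ext\<close>, a new block can be chosen to detect any given nonzero \<open>q\<close>. Each
  block thus lowers the dimension of the annihilator until it is zero, and \<open>card I\<close>
  blocks suffice.\<close>

lemma nondeg_greedy:
  fixes w :: "nat \<Rightarrow> 'k \<Rightarrow> 'i \<Rightarrow> (nat \<Rightarrow> 'a) \<Rightarrow> real"
  assumes I: "finite I"
    and loc: "\<And>n k i v v'. i \<in> I \<Longrightarrow> k \<in> K \<Longrightarrow> (\<And>l. l < Suc n * L \<Longrightarrow> v' l = v l) \<Longrightarrow>
      w n k i v' = w n k i v"
    and ext: "\<And>n v q. \<exists>i\<in>I. q i \<noteq> 0 \<Longrightarrow>
      \<exists>v' k. (\<forall>l<n * L. v' l = v l) \<and> k \<in> K \<and> (\<Sum>i\<in>I. q i * w n k i v') \<noteq> 0"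
  shows "\<exists>v. nondeg ({..<card I} \<times> K) I (\<lambda>(n, k) i. w n k i v)"
proof -
  define ann where "ann m v q \<longleftrightarrow> (\<forall>n<m. \<forall>k\<in>K. (\<Sum>i\<in>I. q i * w n k i v) = 0)" for m v q
  have annD: "ann m v q \<Longrightarrow> n < m \<Longrightarrow> k \<in> K \<Longrightarrow> (\<Sum>i\<in>I. q i * w n k i v) = 0" for m v q n k
    by (simp add: ann_def)
  \<comment> \<open>The dimension count is expressed by supports: after \<open>card J\<close>
    blocks, no nonzero annihilator is supported in \<open>J\<close>.\<close>
  have "\<exists>v. \<forall>q. (\<forall>i\<in>I - J. q i = 0) \<longrightarrow> ann (card J) v q \<longrightarrow> (\<forall>i\<in>I. q i = 0)"
    if "J \<subseteq> I" for J
    using finite_subset[OF that I] that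
  proof (induction J rule: finite_induct)
    case empty
    then show ?case by simp
  next
    case (insert i0 J)
    then obtain v where v: "\<And>q. \<forall>i\<in>I - J. q i = 0 \<Longrightarrow> ann (card J) v q \<Longrightarrow> \<forall>i\<in>I. q i = 0"
      by blast
    have card: "card (insert i0 J) = Suc (card J)" using insert by simp
    show ?case
    proof (cases "\<exists>q. (\<forall>i\<in>I - insert i0 J. q i = 0) \<and> ann (card J) v q \<and> (\<exists>i\<in>I. q i \<noteq> 0)")
      case False
      have "ann (Suc (card J)) v q \<Longrightarrow> ann (card J) v q" for q by (simp add: ann_def)
      with False show ?thesis unfolding card by blast
    next
      case True
      then obtain p where p: "\<forall>i\<in>I - insert i0 J. p i = 0" "ann (card J) v p" "\<exists>i\<in>I. p i \<noteq> 0"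
        by blast
      have "p i0 \<noteq> 0"
      proof
        assume "p i0 = 0"
        then have "\<forall>i\<in>I - J. p i = 0" using p(1) by auto
        then show False using v[of p] p(2,3) by blast
      qed
      obtain v' k where v': "\<And>l. l < card J * L \<Longrightarrow> v' l = v l" "k \<in> K"
        "(\<Sum>i\<in>I. p i * w (card J) k i v') \<noteq> 0"
        using ext[OF p(3), of "card J" v] by blast
      have same: "w n k i v' = w n k i v" if "n < card J" "i \<in> I" "k \<in> K" for n k i
      proof (rule loc[OF that(2,3)])
        fix l assume "l < Suc n * L"
        also have "Suc n * L \<le> card J * L" using that by (intro mult_right_mono) auto
        finally show "v' l = v l" by (rule v')
      qed
      show ?thesis
      proof (intro exI[of _ v'] allI impI)
        fix q assume q: "\<forall>i\<in>I - insert i0 J. q i = 0" "ann (card (insert i0 J)) v' q"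
        \<comment> \<open>Subtracting \<open>c\<close> times \<open>p\<close> clears the coordinate
          \<open>i0\<close> and moves the support into \<open>J\<close>, so \<open>q\<close> equals
          \<open>c\<close> times \<open>p\<close> on \<open>I\<close>. The new row, which
          \<open>p\<close> does not annihilate, then forces \<open>c = 0\<close>.\<close>
        define c where "c = q i0 / p i0"
        have sub: "(\<Sum>i\<in>I. (q i - c * p i) * a i) = (\<Sum>i\<in>I. q i * a i) - c * (\<Sum>i\<in>I. p i * a i)"
          for a :: "'i \<Rightarrow> real"
          by (simp add: sum_distrib_left algebra_simps flip: sum_subtractf)
        have z: "\<forall>i\<in>I. q i - c * p i = 0"
        proof (rule v)
          show "\<forall>i\<in>I - J. q i - c * p i = 0"
          proof
            fix i assume "i \<in> I - J"
            then show "q i - c * p i = 0"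
              using q(1) p(1) \<open>p i0 \<noteq> 0\<close> by (cases "i = i0") (simp_all add: c_def)
          qed
          show "ann (card J) v (\<lambda>i. q i - c * p i)"
            unfolding ann_def
          proof (intro allI impI ballI)
            fix n k assume nk: "n < card J" "k \<in> K"
            then have "(\<Sum>i\<in>I. q i * w n k i v) = (\<Sum>i\<in>I. q i * w n k i v')"
              using same by (intro sum.cong) auto
            also have "\<dots> = 0" using annD[OF q(2), of n k] nk card by simp
            finally show "(\<Sum>i\<in>I. (q i - c * p i) * w n k i v) = 0"
              unfolding sub using annD[OF p(2) nk] by simp
          qed
        qed
        have "(\<Sum>i\<in>I. (q i - c * p i) * w (card J) k i v') = 0"
          using z by (intro sum.neutral) auto
        then have "c = 0" unfolding sub using annD[OF q(2), of "card J" k] v' card by simp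
        then show "\<forall>i\<in>I. q i = 0" using z by simp
      qed
    qed
  qed
  from this[OF order_refl] obtain v where v: "\<And>q. ann (card I) v q \<Longrightarrow> \<forall>i\<in>I. q i = 0"
    by auto
  show ?thesis unfolding nondeg_def
  proof (intro exI[of _ v] allI impI)
    fix q assume q: "\<forall>k\<in>{..<card I} \<times> K. (\<Sum>i\<in>I. q i * (case k of (n, k) \<Rightarrow> \<lambda>i. w n k i v) i) = 0"
    show "\<forall>i\<in>I. q i = 0"
    proof (rule v, unfold ann_def, intro allI impI ballI)
      fix n k assume "n < card I" "k \<in> K"
      then show "(\<Sum>i\<in>I. q i * w n k i v) = 0" using bspec[OF q, of "(n, k)"] by simp
    qed
  qed
qed

section \<open>Polynomial functions of the potential\<close>

inductive_set pol :: "nat \<Rightarrow> ((nat \<Rightarrow> real) \<Rightarrow> real) set" for T :: nat where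
  pol_const: "(\<lambda>V. c) \<in> pol T"
| pol_coord: "k < T \<Longrightarrow> (\<lambda>V. V k) \<in> pol T"
| pol_add: "f \<in> pol T \<Longrightarrow> g \<in> pol T \<Longrightarrow> (\<lambda>V. f V + g V) \<in> pol T"
| pol_mult: "f \<in> pol T \<Longrightarrow> g \<in> pol T \<Longrightarrow> (\<lambda>V. f V * g V) \<in> pol T"

lemma pol_cong:
  assumes "f \<in> pol T" "\<And>k. k < T \<Longrightarrow> V k = V' k"
  shows "f V = f V'"
  using assms by induction auto

lemma pol_continuous: "f \<in> pol T \<Longrightarrow> continuous_on UNIV f"
  by (induction rule: pol.induct) (auto intro!: continuous_intros continuous_on_product_coordinates)

lemma pol_compose:
  assumes "f \<in> pol L" "\<And>k. k < L \<Longrightarrow> (\<lambda>V. s V k) \<in> pol T"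
  shows "(\<lambda>V. f (s V)) \<in> pol T"
  using assms by induction (auto intro: pol.intros)

text \<open>On a line only a univariate polynomial remains, which has finitely many zeros unless it
  is zero; density of nonvanishing sets rests on this.\<close>

lemma pol_line:
  assumes "f \<in> pol T"
  obtains r where "\<And>t. f (\<lambda>k. V k + t * (V0 k - V k)) = poly r t"
proof -
  have "\<exists>r. \<forall>t. f (\<lambda>k. V k + t * (V0 k - V k)) = poly r t"
    using assms
  proof induction
    case (pol_const c)
    show ?case by (intro exI[of _ "[:c:]"]) simp
  next
    case (pol_coord k)
    show ?case by (intro exI[of _ "[:V k, V0 k - V k:]"]) simp
  next
    case (pol_add f g)
    then show ?case by (metis poly_add)
  next
    case (pol_mult f g)
    then show ?case by (metis poly_mult)
  qed
  then show ?thesis using that by blast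
qed

section \<open>Finite-dimensional spaces of polynomial functions\<close>

interpretation fv: vector_space "\<lambda>(c::real) (f :: 'a \<Rightarrow> real) x. c * f x"
  by unfold_locales (auto simp: fun_eq_iff algebra_simps)

lemma span_pol: "B \<subseteq> pol T \<Longrightarrow> fv.span B \<subseteq> pol T"
proof
  fix f assume "f \<in> fv.span B" and B: "B \<subseteq> pol T"
  then show "f \<in> pol T"
  proof (induction rule: fv.span_induct_alt)
    case base
    then show ?case using pol_const[of 0] by (simp add: zero_fun_def)
  next
    case (step c f g)
    then have "(\<lambda>V. c * f V + g V) \<in> pol T" by (intro pol.intros) auto
    then show ?case by (simp add: plus_fun_def)
  qed
qed

lemma span_times:
  assumes "f \<in> fv.span B" "g \<in> fv.span C"
  shows "(\<lambda>x. f x * g x) \<in> fv.span ((\<lambda>(f, g) x. f x * g x) ` (B \<times> C))" (is "_ \<in> fv.span ?D")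
  using assms(1)
proof (induction rule: fv.span_induct_alt)
  case base
  then show ?case using fv.span_zero[of ?D] by (simp add: zero_fun_def)
next
  case (step c b f)
  have "(\<lambda>x. b x * g x) \<in> fv.span ?D"
    using assms(2)
  proof (induction rule: fv.span_induct_alt)
    case base
    then show ?case using fv.span_zero[of ?D] by (simp add: zero_fun_def)
  next
    case (step d e g)
    have "(\<lambda>x. b x * e x) \<in> fv.span ?D"
      using step(1) \<open>b \<in> B\<close> by (intro fv.span_base) (auto intro!: image_eqI[of _ _ "(b, e)"])
    from fv.span_add[OF fv.span_scale[OF this, of d] step(2)]
    show ?case by (simp add: plus_fun_def algebra_simps)
  qed
  from fv.span_add[OF fv.span_scale[OF this, of c] step(2)]
  show ?case by (simp add: plus_fun_def algebra_simps)
qed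

text \<open>Finite generation is what replaces a bound on the degree: it makes polynomials in the
  potential with coefficients depending on the energies lie in one finite-dimensional space.\<close>

definition fin_gen :: "nat \<Rightarrow> ((nat \<Rightarrow> real) \<Rightarrow> real) set \<Rightarrow> bool" where
  "fin_gen T F \<longleftrightarrow> (\<exists>B. finite B \<and> B \<subseteq> pol T \<and> F \<subseteq> fv.span B)"

lemma fin_gen_finite: "finite B \<Longrightarrow> B \<subseteq> pol T \<Longrightarrow> fin_gen T B"
  unfolding fin_gen_def using fv.span_superset by blast

lemma fin_gen_const: "fin_gen T (range (\<lambda>c V. c))"
  unfolding fin_gen_def
proof (intro exI[of _ "{\<lambda>V. 1}"] conjI)
  have "(\<lambda>V. c) \<in> fv.span {\<lambda>V. 1}" for c
    using fv.span_scale[OF fv.span_base[of "\<lambda>V. 1" "{\<lambda>V. 1}"], of c] by simp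
  then show "range (\<lambda>c V. c) \<subseteq> fv.span {\<lambda>V. 1}" by auto
qed (auto intro: pol_const)

lemma fin_gen_Un:
  assumes "fin_gen T F" "fin_gen T G"
  shows "fin_gen T (F \<union> G)"
proof -
  obtain B C where "finite B" "B \<subseteq> pol T" "F \<subseteq> fv.span B" "finite C" "C \<subseteq> pol T" "G \<subseteq> fv.span C"
    using assms unfolding fin_gen_def by metis
  then show ?thesis
    unfolding fin_gen_def using fv.span_mono[of B "B \<union> C"] fv.span_mono[of C "B \<union> C"]
    by (intro exI[of _ "B \<union> C"]) auto
qed

lemma fin_gen_lincomb:
  assumes "fin_gen T F" "fin_gen T G"
  shows "fin_gen T {\<lambda>V. c * f V + d * g V | c d f g. f \<in> F \<and> g \<in> G}"
proof -
  obtain B where "finite B" "B \<subseteq> pol T" "F \<union> G \<subseteq> fv.span B"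
    using fin_gen_Un[OF assms] unfolding fin_gen_def by metis
  moreover have "{\<lambda>V. c * f V + d * g V | c d f g. f \<in> F \<and> g \<in> G} \<subseteq> fv.span B"
  proof clarify
    fix c d f g assume "f \<in> F" "g \<in> G"
    then have "f \<in> fv.span B" "g \<in> fv.span B" using calculation(3) by auto
    from fv.span_add[OF fv.span_scale[OF this(1), of c] fv.span_scale[OF this(2), of d]]
    show "(\<lambda>V. c * f V + d * g V) \<in> fv.span B" by (simp add: plus_fun_def)
  qed
  ultimately show ?thesis unfolding fin_gen_def by blast
qed

lemma fin_gen_times:
  assumes "fin_gen T F" "fin_gen T G"
  shows "fin_gen T {\<lambda>V. f V * g V | f g. f \<in> F \<and> g \<in> G}"
proof -
  obtain B C where BC: "finite B" "B \<subseteq> pol T" "F \<subseteq> fv.span B" "finite C" "C \<subseteq> pol T"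
    "G \<subseteq> fv.span C"
    using assms unfolding fin_gen_def by metis
  let ?D = "(\<lambda>(f, g) x. f x * g x) ` (B \<times> C)"
  have "finite ?D" using BC by auto
  moreover have "?D \<subseteq> pol T" using BC by (auto intro: pol_mult)
  moreover have "{\<lambda>V. f V * g V | f g. f \<in> F \<and> g \<in> G} \<subseteq> fv.span ?D"
    using span_times[of _ B _ C] BC by blast
  ultimately show ?thesis unfolding fin_gen_def by blast
qed

lemma fin_gen_basis:
  assumes "fin_gen T F"
  obtains B where "finite B" "B \<subseteq> pol T" "fv.independent B" "F \<subseteq> fv.span B"
proof -
  obtain B where B: "finite B" "B \<subseteq> pol T" "F \<subseteq> fv.span B"
    using assms unfolding fin_gen_def by metis
  obtain C where C: "C \<subseteq> B" "fv.independent C" "B \<subseteq> fv.span C"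
    using fv.maximal_independent_subset by blast
  have "F \<subseteq> fv.span C"
    using B(3) fv.span_minimal[OF C(3) fv.subspace_span] by blast
  then show ?thesis using that[of C] B C finite_subset by blast
qed

text \<open>Full rank at \<open>V0\<close> is certified by the product of the pivots met in
  division-free elimination. The order of quantifiers is the point: \<open>G\<close> is fixed before
  \<open>w\<close> and \<open>V0\<close>, so one finite-dimensional space serves all
  energies.\<close>

lemma nondeg_open_condition:
  assumes "finite I" "fin_gen T F"
  shows "\<exists>G. fin_gen T G \<and> (\<forall>w V0. (\<forall>k\<in>K. \<forall>i\<in>I. w k i \<in> F) \<longrightarrow>
    nondeg K I (\<lambda>k i. w k i V0) \<longrightarrow>
    (\<exists>p\<in>G. p V0 \<noteq> 0 \<and> (\<forall>V. p V \<noteq> 0 \<longrightarrow> nondeg K I (\<lambda>k i. w k i V))))"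
  using assms
proof (induction I arbitrary: F rule: finite_induct)
  case empty
  show ?case
    by (intro exI[of _ "range (\<lambda>c V. c)"] conjI fin_gen_const)
      (auto simp: nondeg_def intro!: exI[of _ "1::real"])
next
  case (insert i0 I)
  \<comment> \<open>\<open>F'\<close> contains every entry that one elimination step can produce,
    whatever the pivot.\<close>
  define F2 where "F2 = {\<lambda>V. f V * g V | f g. f \<in> F \<and> g \<in> F}"
  define F' where "F' = {\<lambda>V. c * f V + d * g V | c d f g. f \<in> F2 \<and> g \<in> F2}"
  have "fin_gen T F'"
    unfolding F'_def F2_def by (intro fin_gen_lincomb fin_gen_times insert.prems)
  then obtain G where G: "fin_gen T G" and G': "\<And>w V0. \<forall>k\<in>K. \<forall>i\<in>I. w k i \<in> F' \<Longrightarrow>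
    nondeg K I (\<lambda>k i. w k i V0) \<Longrightarrow>
    \<exists>p\<in>G. p V0 \<noteq> 0 \<and> (\<forall>V. p V \<noteq> 0 \<longrightarrow> nondeg K I (\<lambda>k i. w k i V))"
    using insert.IH by blast
  show ?case
  proof (intro exI conjI allI impI)
    show "fin_gen T {\<lambda>V. f V * g V | f g. f \<in> G \<and> g \<in> F}"
      by (rule fin_gen_times[OF G insert.prems])
    fix w V0
    assume w: "\<forall>k\<in>K. \<forall>i\<in>insert i0 I. w k i \<in> F" and nd: "nondeg K (insert i0 I) (\<lambda>k i. w k i V0)"
    obtain k0 where k0: "k0 \<in> K" "w k0 i0 V0 \<noteq> 0"
      using nondeg_insert_pivot[OF nd insert.hyps] .
    define w' where "w' k i = (\<lambda>V. w k0 i0 V * w k i V - w k i0 V * w k0 i V)" for k i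
    have "w' k i \<in> F'" if "k \<in> K" "i \<in> I" for k i
    proof -
      have "(\<lambda>V. w k0 i0 V * w k i V) \<in> F2" "(\<lambda>V. w k i0 V * w k0 i V) \<in> F2"
        unfolding F2_def using w that k0 by auto
      then have "(\<lambda>V. 1 * (w k0 i0 V * w k i V) + (-1) * (w k i0 V * w k0 i V)) \<in> F'"
        unfolding F'_def mem_Collect_eq by - (intro exI conjI, rule refl)
      then show ?thesis by (simp add: w'_def)
    qed
    moreover have "nondeg K I (\<lambda>k i. w' k i V0)"
      unfolding w'_def by (rule nondeg_eliminate[OF nd insert.hyps k0(2,1)])
    ultimately obtain p where p: "p \<in> G" "p V0 \<noteq> 0"
      "\<And>V. p V \<noteq> 0 \<Longrightarrow> nondeg K I (\<lambda>k i. w' k i V)"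
      using G'[of w' V0] by blast
    show "\<exists>p\<in>{\<lambda>V. f V * g V | f g. f \<in> G \<and> g \<in> F}. p V0 \<noteq> 0 \<and>
        (\<forall>V. p V \<noteq> 0 \<longrightarrow> nondeg K (insert i0 I) (\<lambda>k i. w k i V))"
    proof (intro bexI[of _ "\<lambda>V. p V * w k0 i0 V"] conjI allI impI)
      fix V assume "p V * w k0 i0 V \<noteq> 0"
      then have *: "p V \<noteq> 0" "w k0 i0 V \<noteq> 0" by auto
      show "nondeg K (insert i0 I) (\<lambda>k i. w k i V)"
        using nondeg_uneliminate[OF p(3)[OF *(1), unfolded w'_def] insert.hyps *(2) k0(1)] .
    qed (use p k0 w in auto)
  qed
qed

section \<open>Rows of squared solutions\<close>

lemma Amat_nth [simp]:
  "Amat t $ 1 $ 1 = t" "Amat t $ 1 $ 2 = -1" "Amat t $ 2 $ 1 = 1" "Amat t $ 2 $ 2 = 0"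
  by (simp_all add: Amat_def)

lemma matrix_mult_2:
  fixes A B :: "real^2^2"
  shows "(A ** B) $ i $ j = A $ i $ 1 * B $ 1 $ j + A $ i $ 2 * B $ 2 $ j"
  by (simp add: matrix_matrix_mult_def sum_2)

lemma transfer_Suc_nth:
  "transfer (Suc k) e V $ 1 $ j = (e - V k) * transfer k e V $ 1 $ j - transfer k e V $ 2 $ j"
  "transfer (Suc k) e V $ 2 $ j = transfer k e V $ 1 $ j"
  by (simp_all add: matrix_mult_2)

lemma transfer_0_nth:
  "transfer 0 e V $ 1 $ 1 = 1" "transfer 0 e V $ 1 $ 2 = 0"
  "transfer 0 e V $ 2 $ 1 = 0" "transfer 0 e V $ 2 $ 2 = 1"
  by (simp_all add: mat_def)

lemma transfer_cong: "(\<And>l. l < k \<Longrightarrow> V l = V' l) \<Longrightarrow> transfer k e V = transfer k e V'"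
  by (induction k) auto

text \<open>The energy enters only through scalar coefficients, so \<open>F\<close> can be chosen
  before \<open>e\<close>.\<close>

lemma fin_gen_transfer:
  "\<exists>F. fin_gen L F \<and> (\<forall>e i j. (\<lambda>V. transfer k e V $ i $ j) \<in> F)" if "k \<le> L"
  using that
proof (induction k)
  case 0
  have "(\<lambda>V. transfer 0 e V $ i $ j) \<in> range (\<lambda>c V. c)" for e i j by simp
  then show ?case using fin_gen_const by blast
next
  case (Suc k)
  then obtain F where F: "fin_gen L F" "\<And>e i j. (\<lambda>V. transfer k e V $ i $ j) \<in> F" by auto
  define G where "G = {\<lambda>V. f V * g V | f g. f \<in> {\<lambda>V. V k} \<and> g \<in> F}"
  define H where "H = {\<lambda>V. c * f V + d * g V | c d f g. f \<in> F \<and> g \<in> F}"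
  define J where "J = {\<lambda>V. c * f V + d * g V | c d f g. f \<in> H \<and> g \<in> G}"
  have "fin_gen L {\<lambda>V. V k}" using Suc.prems by (intro fin_gen_finite) (auto intro: pol_coord)
  then have J: "fin_gen L J"
    unfolding J_def G_def H_def by (intro fin_gen_lincomb fin_gen_times F)
  have "(\<lambda>V. transfer (Suc k) e V $ i $ j) \<in> J \<union> F" for e i j
  proof (cases "i = 1")
    case True
    have G: "(\<lambda>V. V k * transfer k e V $ 1 $ j) \<in> G"
      unfolding G_def mem_Collect_eq by (intro exI conjI, rule refl) (simp_all add: F)
    have H: "(\<lambda>V. e * transfer k e V $ 1 $ j + (-1) * transfer k e V $ 2 $ j) \<in> H"
      unfolding H_def mem_Collect_eq by (intro exI conjI, rule refl) (simp_all add: F)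
    have "(\<lambda>V. 1 * (e * transfer k e V $ 1 $ j + (-1) * transfer k e V $ 2 $ j)
        + (-1) * (V k * transfer k e V $ 1 $ j)) \<in> J"
      unfolding J_def mem_Collect_eq by (intro exI conjI, rule refl) (rule G H)+
    then show ?thesis using True by (simp add: transfer_Suc_nth algebra_simps del: transfer.simps)
  next
    case False
    then have "i = 2" using exhaust_2 by blast
    then show ?thesis using F(2) by (simp add: transfer_Suc_nth del: transfer.simps)
  qed
  then show ?case using fin_gen_Un[OF J F(1)] by blast
qed

text \<open>Index \<open>i = 3 * j + r\<close> stands for the component \<open>r\<close> of the energy \<open>E j\<close>. Row \<open>k\<close> is the partial
  derivative of the transfer matrices with respect to \<open>V k\<close>, translated back to the Lie algebra,
  whose entries are \<open>\<plusminus>a\<^sup>2, \<plusminus>ab, \<plusminus>b\<^sup>2\<close> for the first row \<open>(a, b)\<close> of the \<open>k\<close>-step transfer matrix.\<close>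

definition sq_row :: "(nat \<Rightarrow> real) \<Rightarrow> (nat \<Rightarrow> real) \<Rightarrow> nat \<Rightarrow> nat \<Rightarrow> real" where
  "sq_row E V k i = (let u = transfer k (E (i div 3)) V $ 1 in
     if i mod 3 = 0 then (u $ 1)\<^sup>2 else if i mod 3 = 1 then u $ 1 * u $ 2 else (u $ 2)\<^sup>2)"

lemma fin_gen_sq_row:
  "\<exists>F. fin_gen L F \<and> (\<forall>k<L. \<forall>E i. (\<lambda>V. sq_row E V k i) \<in> F)"
proof -
  have "\<exists>F. fin_gen L F \<and> (\<forall>k<n. \<forall>E i. (\<lambda>V. sq_row E V k i) \<in> F)" if "n \<le> L" for n
    using that
  proof (induction n)
    case 0
    then show ?case using fin_gen_const by blast
  next
    case (Suc n)
    then obtain F where F: "fin_gen L F" "\<forall>k<n. \<forall>E i. (\<lambda>V. sq_row E V k i) \<in> F" by auto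
    obtain G where G: "fin_gen L G" "\<And>e i j. (\<lambda>V. transfer n e V $ i $ j) \<in> G"
      using fin_gen_transfer[of n L] Suc.prems by auto
    let ?GG = "{\<lambda>V. f V * g V | f g. f \<in> G \<and> g \<in> G}"
    have "(\<lambda>V. transfer n e V $ i $ j * transfer n e' V $ i' $ j') \<in> ?GG" for e i j e' i' j'
      unfolding mem_Collect_eq by (intro exI conjI, rule refl) (rule G)+
    then have "(\<lambda>V. sq_row E V n i) \<in> ?GG" for E i
      unfolding sq_row_def Let_def power2_eq_square by (cases "i mod 3 = 0"; cases "i mod 3 = 1") simp_all
    then show ?case
      using F fin_gen_Un[OF F(1) fin_gen_times[OF G(1) G(1)]]
      by (intro exI[of _ "F \<union> ?GG"]) (auto simp: less_Suc_eq)
  qed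
  then show ?thesis by blast
qed

lemma sum_lessThan_mult_3:
  fixes N :: nat
  shows "(\<Sum>i<3 * N. f i) = (\<Sum>j<N. f (3 * j) + f (3 * j + 1) + (f (3 * j + 2) :: real))"
proof (induction N)
  case (Suc N)
  have "3 * Suc N = Suc (Suc (Suc (3 * N)))" by simp
  then show ?case by (simp only: sum.lessThan_Suc) (simp add: Suc.IH)
qed simp

section \<open>Observability for distinct energies\<close>

text \<open>The coefficients \<open>q\<close> define a binary quadratic form for every energy \<open>E j\<close>. The numbers
  \<open>formX, formY, formZ\<close> are its values on the pairs (first, first), (first, second), (second, second)
  of rows of the transfer matrix, so that they evolve linearly in \<open>k\<close>.\<close>

definition formX :: "(nat \<Rightarrow> real) \<Rightarrow> (nat \<Rightarrow> real) \<Rightarrow> (nat \<Rightarrow> real) \<Rightarrow> nat \<Rightarrow> nat \<Rightarrow> real" where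
  "formX E q V k j = (let M = transfer k (E j) V in
     q (3 * j) * (M $ 1 $ 1)\<^sup>2 + q (3 * j + 1) * (M $ 1 $ 1 * M $ 1 $ 2) + q (3 * j + 2) * (M $ 1 $ 2)\<^sup>2)"

definition formY :: "(nat \<Rightarrow> real) \<Rightarrow> (nat \<Rightarrow> real) \<Rightarrow> (nat \<Rightarrow> real) \<Rightarrow> nat \<Rightarrow> nat \<Rightarrow> real" where
  "formY E q V k j = (let M = transfer k (E j) V in
     q (3 * j) * (M $ 1 $ 1 * M $ 2 $ 1)
     + q (3 * j + 1) * ((M $ 1 $ 1 * M $ 2 $ 2 + M $ 1 $ 2 * M $ 2 $ 1) / 2)
     + q (3 * j + 2) * (M $ 1 $ 2 * M $ 2 $ 2))"

definition formZ :: "(nat \<Rightarrow> real) \<Rightarrow> (nat \<Rightarrow> real) \<Rightarrow> (nat \<Rightarrow> real) \<Rightarrow> nat \<Rightarrow> nat \<Rightarrow> real" where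
  "formZ E q V k j = (let M = transfer k (E j) V in
     q (3 * j) * (M $ 2 $ 1)\<^sup>2 + q (3 * j + 1) * (M $ 2 $ 1 * M $ 2 $ 2) + q (3 * j + 2) * (M $ 2 $ 2)\<^sup>2)"

lemma form_0: "formX E q V 0 j = q (3 * j)" "formY E q V 0 j = q (3 * j + 1) / 2" "formZ E q V 0 j = q (3 * j + 2)"
  by (simp_all add: formX_def formY_def formZ_def transfer_0_nth del: transfer.simps)

lemma form_Suc:
  "formX E q V (Suc k) j =
     (E j - V k)\<^sup>2 * formX E q V k j - 2 * (E j - V k) * formY E q V k j + formZ E q V k j"
  "formY E q V (Suc k) j = (E j - V k) * formX E q V k j - formY E q V k j"
  "formZ E q V (Suc k) j = formX E q V k j"
  by (simp_all add: formX_def formY_def formZ_def Let_def transfer_Suc_nth power2_eq_square field_simps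
      del: transfer.simps)

lemma form_cong:
  assumes "\<And>l. l < k \<Longrightarrow> V l = V' l"
  shows "formX E q V k j = formX E q V' k j" "formY E q V k j = formY E q V' k j"
    "formZ E q V k j = formZ E q V' k j"
  using transfer_cong[of k V V' "E j"] assms by (simp_all add: formX_def formY_def formZ_def)

text \<open>The one-step recursion for the three values is invertible, so their vanishing at step
  \<open>k\<close> can be traced back to step \<open>0\<close>.\<close>

lemma form_eq_0_imp:
  assumes "formX E q V k j = 0" "formY E q V k j = 0" "formZ E q V k j = 0"
  shows "q (3 * j) = 0" "q (3 * j + 1) = 0" "q (3 * j + 2) = 0"
proof -
  from assms have "formX E q V 0 j = 0 \<and> formY E q V 0 j = 0 \<and> formZ E q V 0 j = 0"
    by (induction k) (auto simp: form_Suc)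
  then show "q (3 * j) = 0" "q (3 * j + 1) = 0" "q (3 * j + 2) = 0" by (auto simp: form_0)
qed

lemma sum_sq_row:
  "(\<Sum>i<3 * N. q i * sq_row E V k i) = (\<Sum>j<N. formX E q V k j)"
proof -
  have "3 * j div 3 = j" "(3 * j + 1) div 3 = j" "(3 * j + 2) div 3 = j"
    "3 * j mod 3 = 0" "(3 * j + 1) mod 3 = 1" "(3 * j + 2) mod 3 = 2" for j :: nat
    by presburger+
  then show ?thesis by (simp only: sum_lessThan_mult_3 sq_row_def formX_def Let_def) simp
qed

lemma sq_row_cong: "(\<And>l. l < k \<Longrightarrow> V l = V' l) \<Longrightarrow> sq_row E V k i = sq_row E V' k i"
  using transfer_cong[of k V V'] by (simp add: sq_row_def)

lemma quadratic_zero_coeffs: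
  fixes a b c :: real
  assumes "\<And>v. v\<^sup>2 * a + v * b + c = 0"
  shows "a = 0" "b = 0" "c = 0"
  using assms[of 0] assms[of 1] assms[of "-1"] by auto

text \<open>Invertibility of the Vandermonde matrix, by interpolation: pairing \<open>x\<close> with
  a polynomial of degree below \<open>N\<close> that vanishes at all \<open>E i\<close> except
  \<open>E j\<close> isolates \<open>x j\<close>.\<close>

lemma moments_zero_imp_zero:
  fixes x :: "nat \<Rightarrow> real"
  assumes inj: "inj_on E {..<N}" and mom: "\<And>n. n < N \<Longrightarrow> (\<Sum>j<N. E j ^ n * x j) = 0" and j: "j < N"
  shows "x j = 0"
proof -
  define p where "p = (\<Prod>i\<in>{..<N} - {j}. [:- E i, 1:])"
  have "degree p < N"
  proof -
    have "degree p \<le> sum (degree \<circ> (\<lambda>i. [:- E i, 1:])) ({..<N} - {j})"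
      unfolding p_def by (rule degree_prod_sum_le) simp
    also have "\<dots> = N - 1" using j by simp
    finally show ?thesis using j by simp
  qed
  then have coeff: "(\<Sum>n<N. Polynomial.coeff p n * t ^ n) = poly p t" for t
    unfolding poly_altdef by (intro sum.mono_neutral_right) (auto simp: Polynomial.coeff_eq_0)
  have "(\<Sum>i<N. poly p (E i) * x i) = (\<Sum>n<N. Polynomial.coeff p n * (\<Sum>i<N. E i ^ n * x i))"
    by (subst sum_distrib_left, subst sum.swap)
      (simp add: sum_distrib_right mult.assoc flip: coeff)
  also have "\<dots> = 0" using mom by (intro sum.neutral) auto
  finally have s: "(\<Sum>i<N. poly p (E i) * x i) = 0" .
  have "poly p (E i) = 0" if "i < N" "i \<noteq> j" for i
    using that unfolding p_def poly_prod by (intro prod_zero) auto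
  then have "(\<Sum>i<N. poly p (E i) * x i) = (\<Sum>i\<in>{j}. poly p (E i) * x i)"
    using j by (intro sum.mono_neutral_right) auto
  moreover have "poly p (E j) \<noteq> 0"
    using inj j unfolding p_def poly_prod by (auto simp: inj_on_def)
  ultimately show ?thesis using s by simp
qed

text \<open>The forms \<open>q\<close> leave no trace in the rows \<open>m\<close> to
  \<open>m + d\<close>, whatever potential values are used from index \<open>m\<close> on; only the
  values below \<open>m\<close> are fixed.\<close>

definition unseen :: "nat \<Rightarrow> (nat \<Rightarrow> real) \<Rightarrow> (nat \<Rightarrow> real) \<Rightarrow> nat \<Rightarrow> (nat \<Rightarrow> real) \<Rightarrow> nat \<Rightarrow> bool" where
  "unseen N E q m V d \<longleftrightarrow> (\<forall>V' k. (\<forall>l<m. V' l = V l) \<longrightarrow> m \<le> k \<longrightarrow> k \<le> m + d \<longrightarrow>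
     (\<Sum>j<N. formX E q V' k j) = 0)"

lemma unseen_mono: "unseen N E q m V d \<Longrightarrow> d' \<le> d \<Longrightarrow> unseen N E q m V d'"
  unfolding unseen_def by auto

text \<open>Prescribing one more potential value costs one step of the horizon.\<close>

lemma unseen_Suc:
  assumes "unseen N E q m V (Suc d)"
  shows "unseen N E q (Suc m) (V(m := v)) d"
  using assms unfolding unseen_def
proof (intro allI impI)
  fix V' k
  assume a: "\<forall>V' k. (\<forall>l<m. V' l = V l) \<longrightarrow> m \<le> k \<longrightarrow> k \<le> m + Suc d \<longrightarrow> (\<Sum>j<N. formX E q V' k j) = 0"
    and b: "\<forall>l<Suc m. V' l = (V(m := v)) l" "Suc m \<le> k" "k \<le> Suc m + d"
  have "\<forall>l<m. V' l = V l" using b(1) by (metis fun_upd_apply less_SucI less_irrefl)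
  with a b show "(\<Sum>j<N. formX E q V' k j) = 0" by simp
qed

lemma form_Suc_upd:
  "formX E q (V(m := v)) (Suc m) j =
     (E j - v)\<^sup>2 * formX E q V m j - 2 * (E j - v) * formY E q V m j + formZ E q V m j"
  "formY E q (V(m := v)) (Suc m) j = (E j - v) * formX E q V m j - formY E q V m j"
  using form_cong[of m "V(m := v)" V] by (simp_all add: form_Suc)

lemma expand_X_moment:
  "(\<Sum>j<N. E j ^ n * formX E q (V(m := v)) (Suc m) j) =
     v\<^sup>2 * (\<Sum>j<N. E j ^ n * formX E q V m j)
     + v * (\<Sum>j<N. 2 * (E j ^ n * formY E q V m j) - 2 * (E j ^ Suc n * formX E q V m j))
     + (\<Sum>j<N. E j ^ Suc (Suc n) * formX E q V m j - 2 * (E j ^ Suc n * formY E q V m j)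
          + E j ^ n * formZ E q V m j)"
  unfolding sum_distrib_left sum.distrib[symmetric] form_Suc_upd
  by (intro sum.cong) (simp_all add: power2_eq_square algebra_simps)

text \<open>One step at potential \<open>v\<close> turns a vanishing moment into a quadratic polynomial in \<open>v\<close> that
  vanishes identically. Its linear coefficient, followed one step further by the leading
  coefficient, raises the moment of \<open>formX\<close> by one.\<close>

lemma unseen_X_moment:
  "unseen N E q m V (2 * n) \<Longrightarrow> (\<Sum>j<N. E j ^ n * formX E q V m j) = 0"
proof (induction n arbitrary: m V)
  case 0
  then show ?case by (auto simp: unseen_def)
next
  case (Suc n)
  have lin: "(\<Sum>j<N. 2 * (E j ^ n * formY E q V m j) - 2 * (E j ^ Suc n * formX E q V m j)) = 0"
    if "unseen N E q m V (Suc (2 * n))" for m V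
  proof (rule quadratic_zero_coeffs(2))
    fix v
    show "v\<^sup>2 * (\<Sum>j<N. E j ^ n * formX E q V m j)
     + v * (\<Sum>j<N. 2 * (E j ^ n * formY E q V m j) - 2 * (E j ^ Suc n * formX E q V m j))
     + (\<Sum>j<N. E j ^ Suc (Suc n) * formX E q V m j - 2 * (E j ^ Suc n * formY E q V m j)
          + E j ^ n * formZ E q V m j) = 0"
      unfolding expand_X_moment[symmetric] by (rule Suc.IH[OF unseen_Suc[OF that]])
  qed
  have "-2 * (\<Sum>j<N. E j ^ Suc n * formX E q V m j) = 0"
  proof (rule quadratic_zero_coeffs(1))
    fix v
    have "unseen N E q (Suc m) (V(m := v)) (Suc (2 * n))"
      using Suc.prems by (intro unseen_Suc) simp
    from lin[OF this]
    show "v\<^sup>2 * (-2 * (\<Sum>j<N. E j ^ Suc n * formX E q V m j))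
      + v * (\<Sum>j<N. 4 * (E j ^ Suc (Suc n) * formX E q V m j) - 4 * (E j ^ Suc n * formY E q V m j)
          - 2 * (E j ^ n * formX E q V m j))
      + (\<Sum>j<N. 2 * (E j ^ Suc n * formX E q V m j - E j ^ n * formY E q V m j)
          - 2 * (E j ^ Suc (Suc (Suc n)) * formX E q V m j - 2 * (E j ^ Suc (Suc n) * formY E q V m j)
            + E j ^ Suc n * formZ E q V m j)) = 0"
      unfolding sum_distrib_left sum.distrib[symmetric] form_Suc_upd
      by (simp add: power2_eq_square algebra_simps)
  qed
  then show ?case by simp
qed

text \<open>The linear coefficient of the quadratic in \<open>v\<close> links this moment to the
  \<open>formX\<close> moment of order \<open>Suc n\<close>, which vanishes within the same
  horizon.\<close>

lemma unseen_Y_moment: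
  assumes "unseen N E q m V (2 * n + 2)"
  shows "(\<Sum>j<N. E j ^ n * formY E q V m j) = 0"
proof -
  have "(\<Sum>j<N. 2 * (E j ^ n * formY E q V m j) - 2 * (E j ^ Suc n * formX E q V m j)) = 0"
  proof (rule quadratic_zero_coeffs(2))
    fix v
    show "v\<^sup>2 * (\<Sum>j<N. E j ^ n * formX E q V m j)
     + v * (\<Sum>j<N. 2 * (E j ^ n * formY E q V m j) - 2 * (E j ^ Suc n * formX E q V m j))
     + (\<Sum>j<N. E j ^ Suc (Suc n) * formX E q V m j - 2 * (E j ^ Suc n * formY E q V m j)
          + E j ^ n * formZ E q V m j) = 0"
      unfolding expand_X_moment[symmetric]
      using unseen_mono[OF assms, of "Suc (2 * n)"] by (intro unseen_X_moment unseen_Suc) simp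
  qed
  moreover have "(\<Sum>j<N. E j ^ Suc n * formX E q V m j) = 0"
    using assms by (intro unseen_X_moment) simp
  ultimately show ?thesis
    by (simp add: sum_subtractf flip: sum_distrib_left)
qed

text \<open>Here the constant coefficient is used. The \<open>formX\<close> moment of order
  \<open>n + 2\<close> and the \<open>formY\<close> moment of order \<open>n + 1\<close> must vanish
  as well, and both need horizon \<open>2 * n + 4\<close>.\<close>

lemma unseen_Z_moment:
  assumes "unseen N E q m V (2 * n + 4)"
  shows "(\<Sum>j<N. E j ^ n * formZ E q V m j) = 0"
proof -
  have "(\<Sum>j<N. E j ^ Suc (Suc n) * formX E q V m j - 2 * (E j ^ Suc n * formY E q V m j)
          + E j ^ n * formZ E q V m j) = 0"
  proof (rule quadratic_zero_coeffs(3))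
    fix v
    show "v\<^sup>2 * (\<Sum>j<N. E j ^ n * formX E q V m j)
     + v * (\<Sum>j<N. 2 * (E j ^ n * formY E q V m j) - 2 * (E j ^ Suc n * formX E q V m j))
     + (\<Sum>j<N. E j ^ Suc (Suc n) * formX E q V m j - 2 * (E j ^ Suc n * formY E q V m j)
          + E j ^ n * formZ E q V m j) = 0"
      unfolding expand_X_moment[symmetric]
      using unseen_mono[OF assms, of "Suc (2 * n)"] by (intro unseen_X_moment unseen_Suc) simp
  qed
  moreover have "(\<Sum>j<N. E j ^ Suc (Suc n) * formX E q V m j) = 0"
    by (rule unseen_X_moment, rule unseen_mono[OF assms]) simp
  moreover have "(\<Sum>j<N. E j ^ Suc n * formY E q V m j) = 0"
    by (rule unseen_Y_moment, rule unseen_mono[OF assms]) simp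
  ultimately show ?thesis
    by (simp add: sum_subtractf sum.distrib flip: sum_distrib_left)
qed

lemma sq_row_separates:
  assumes inj: "inj_on E {..<N}" and q: "\<exists>i\<in>{..<3 * N}. q i \<noteq> 0"
  shows "\<exists>V' k. (\<forall>l<m. V' l = V l) \<and> k < 2 * N + 3 \<and> (\<Sum>i<3 * N. q i * sq_row E V' (m + k) i) \<noteq> 0"
proof (rule ccontr)
  assume "\<not> ?thesis"
  then have *: "(\<Sum>j<N. formX E q V' (m + k) j) = 0" if "\<forall>l<m. V' l = V l" "k < 2 * N + 3" for V' k
    using that by (auto simp: sum_sq_row)
  \<comment> \<open>The most demanding moment is that of \<open>formZ\<close> of order
    \<open>N - 1\<close>, with horizon \<open>2 * (N - 1) + 4\<close>; this accounts for the
    \<open>2 * N + 3\<close> rows.\<close>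
  have "unseen N E q m V (2 * N + 2)"
    unfolding unseen_def
  proof (intro allI impI)
    fix V' k assume "\<forall>l<m. V' l = V l" "m \<le> k" "k \<le> m + (2 * N + 2)"
    then show "(\<Sum>j<N. formX E q V' k j) = 0" using *[of V' "k - m"] by simp
  qed
  note un = unseen_mono[OF this]
  obtain i where i: "i < 3 * N" "q i \<noteq> 0" using q by blast
  then have j: "i div 3 < N" by auto
  have "formX E q V m (i div 3) = 0" "formY E q V m (i div 3) = 0" "formZ E q V m (i div 3) = 0"
    by (rule moments_zero_imp_zero[OF inj _ j], rule unseen_X_moment unseen_Y_moment unseen_Z_moment,
        rule un, simp)+
  note q0 = form_eq_0_imp[OF this]
  have "i = 3 * (i div 3) \<or> i = 3 * (i div 3) + 1 \<or> i = 3 * (i div 3) + 2" by presburger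
  then show False using q0 i(2) by metis
qed

section \<open>Generic potentials\<close>

lemma nondeg_rows:
  assumes "nondeg K I w" "\<And>k. k \<in> K \<Longrightarrow> \<exists>k'\<in>K'. \<forall>i\<in>I. w k i = w' k' i"
  shows "nondeg K' I w'"
  unfolding nondeg_def
proof (intro allI impI ballI)
  fix q i assume q: "\<forall>k\<in>K'. (\<Sum>i\<in>I. q i * w' k i) = 0" and i: "i \<in> I"
  show "q i = 0"
  proof (rule nondegD[OF assms(1) _ i])
    fix k assume "k \<in> K"
    then obtain k' where k': "k' \<in> K'" "\<forall>i\<in>I. w k i = w' k' i" using assms(2) by blast
    then have "(\<Sum>i\<in>I. q i * w k i) = (\<Sum>i\<in>I. q i * w' k' i)" by (intro sum.cong) auto
    then show "(\<Sum>i\<in>I. q i * w k i) = 0" using q k' by simp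
  qed
qed

text \<open>The forms have \<open>3 * N\<close> coefficients in all, so the greedy choice takes
  \<open>3 * N\<close> blocks of the length given by \<open>sq_row_separates\<close>.\<close>

lemma nondeg_sq_row_exists:
  assumes "inj_on E {..<N}"
  shows "\<exists>V. nondeg {..<3 * N * (2 * N + 3)} {..<3 * N} (sq_row E V)"
proof -
  define L where "L = 2 * N + 3"
  have "\<exists>V. nondeg ({..<card {..<3 * N}} \<times> {..<L}) {..<3 * N}
      (\<lambda>(n, k) i. (\<lambda>n k i V. sq_row E V (n * L + k) i) n k i V)"
  proof (rule nondeg_greedy[of _ "{..<L}" L])
    fix n k i and v v' :: "nat \<Rightarrow> real"
    assume k: "k \<in> {..<L}" and v: "\<And>l. l < Suc n * L \<Longrightarrow> v' l = v l"
    show "sq_row E v' (n * L + k) i = sq_row E v (n * L + k) i"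
      by (rule sq_row_cong, rule v) (use k in simp)
  next
    fix n and v q :: "nat \<Rightarrow> real" assume "\<exists>i\<in>{..<3 * N}. q i \<noteq> 0"
    from sq_row_separates[OF assms this, of "n * L" v]
    show "\<exists>v' k. (\<forall>l<n * L. v' l = v l) \<and> k \<in> {..<L} \<and>
        (\<Sum>i<3 * N. q i * sq_row E v' (n * L + k) i) \<noteq> 0"
      by (simp add: L_def)
  qed simp
  then obtain V where V: "nondeg ({..<3 * N} \<times> {..<L}) {..<3 * N} (\<lambda>(n, k) i. sq_row E V (n * L + k) i)"
    by auto
  have "nondeg {..<3 * N * L} {..<3 * N} (sq_row E V)"
  proof (rule nondeg_rows[OF V], clarify)
    fix n k assume nk: "n < 3 * N" "k < L"
    then have "n * L + k < Suc n * L" by simp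
    also have "Suc n * L \<le> 3 * N * L" using nk by (intro mult_right_mono) auto
    finally show "\<exists>k'\<in>{..<3 * N * L}. \<forall>i\<in>{..<3 * N}. sq_row E V (n * L + k) i = sq_row E V k' i"
      by blast
  qed
  then show ?thesis unfolding L_def by blast
qed

text \<open>\<open>G\<close> is fixed before \<open>E\<close>: for all energies the entries of
  \<open>sq_row\<close> lie in one finitely generated space, and the greedy potential is a point
  where the certificate is nonzero.\<close>

lemma nondeg_sq_row_generic:
  fixes N :: nat
  defines "L \<equiv> 3 * N * (2 * N + 3)"
  obtains G where "fin_gen L G" "\<And>E. inj_on E {..<N} \<Longrightarrow>
     \<exists>p\<in>G. (\<exists>V. p V \<noteq> 0) \<and> (\<forall>V. p V \<noteq> 0 \<longrightarrow> nondeg {..<L} {..<3 * N} (sq_row E V))"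
proof -
  obtain F where F: "fin_gen L F" "\<forall>k<L. \<forall>E i. (\<lambda>V. sq_row E V k i) \<in> F"
    using fin_gen_sq_row[of L] by (elim exE conjE)
  obtain G where G: "fin_gen L G" "\<forall>w V0. (\<forall>k\<in>{..<L}. \<forall>i\<in>{..<3 * N}. w k i \<in> F) \<longrightarrow>
    nondeg {..<L} {..<3 * N} (\<lambda>k i. w k i V0) \<longrightarrow>
    (\<exists>p\<in>G. p V0 \<noteq> 0 \<and> (\<forall>V. p V \<noteq> 0 \<longrightarrow> nondeg {..<L} {..<3 * N} (\<lambda>k i. w k i V)))"
    using nondeg_open_condition[OF finite_lessThan F(1), of "{..<L}" "3 * N"] by (elim exE conjE)
  show ?thesis
  proof (rule that[OF G(1)])
    fix E :: "nat \<Rightarrow> real" assume "inj_on E {..<N}"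
    then obtain V where V: "nondeg {..<L} {..<3 * N} (sq_row E V)"
      using nondeg_sq_row_exists unfolding L_def by blast
    have "\<forall>k\<in>{..<L}. \<forall>i\<in>{..<3 * N}. (\<lambda>V. sq_row E V k i) \<in> F" using F by auto
    from G(2)[THEN spec, of "\<lambda>k i V. sq_row E V k i", THEN spec, of V, THEN mp, OF this, THEN mp, OF V]
    show "\<exists>p\<in>G. (\<exists>V. p V \<noteq> 0) \<and> (\<forall>V. p V \<noteq> 0 \<longrightarrow> nondeg {..<L} {..<3 * N} (sq_row E V))"
      by blast
  qed
qed

section \<open>Transport of forms along an initial stretch of potential\<close>

lemma form_shift:
  assumes q': "\<And>j. q' (3 * j) = formX E q V m j" "\<And>j. q' (3 * j + 1) = 2 * formY E q V m j"
    "\<And>j. q' (3 * j + 2) = formZ E q V m j"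
  shows "formX E q' (\<lambda>l. V (m + l)) k j = formX E q V (m + k) j \<and>
    formY E q' (\<lambda>l. V (m + l)) k j = formY E q V (m + k) j \<and>
    formZ E q' (\<lambda>l. V (m + l)) k j = formZ E q V (m + k) j"
proof (induction k)
  case 0
  then show ?case by (simp only: form_0 q') simp
next
  case (Suc k)
  then show ?case by (simp add: form_Suc)
qed

text \<open>Transporting forms along the first \<open>m\<close> steps is linear and injective. Forms
  annihilated by all rows are transported to forms annihilated by the window starting at
  \<open>m\<close>; these vanish, hence so do the original ones.\<close>

lemma nondeg_sq_row_shift:
  assumes nd: "nondeg {..<L} {..<3 * N} (sq_row E (\<lambda>l. V (m + l)))" and T: "m + L \<le> T"
  shows "nondeg {..<T} {..<3 * N} (sq_row E V)"
  unfolding nondeg_def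
proof (intro allI impI ballI)
  fix q i assume q: "\<forall>k\<in>{..<T}. (\<Sum>i<3 * N. q i * sq_row E V k i) = 0" and i: "i \<in> {..<3 * N}"
  \<comment> \<open>These are the coefficients of the transported forms. \<open>formY\<close> is the
    polar form, hence half of the mixed coefficient, which explains the factor 2.\<close>
  define q' where "q' i = (if i mod 3 = 0 then formX E q V m (i div 3)
    else if i mod 3 = 1 then 2 * formY E q V m (i div 3) else formZ E q V m (i div 3))" for i
  have "3 * j div 3 = j" "(3 * j + 1) div 3 = j" "(3 * j + 2) div 3 = j"
    "3 * j mod 3 = 0" "(3 * j + 1) mod 3 = 1" "(3 * j + 2) mod 3 = 2" for j :: nat
    by presburger+
  then have q'_eq: "q' (3 * j) = formX E q V m j" "q' (3 * j + 1) = 2 * formY E q V m j"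
    "q' (3 * j + 2) = formZ E q V m j" for j
    by (simp_all only: q'_def) simp_all
  have "(\<Sum>i<3 * N. q' i * sq_row E (\<lambda>l. V (m + l)) k i) = 0" if "k < L" for k
  proof -
    have "(\<Sum>i<3 * N. q' i * sq_row E (\<lambda>l. V (m + l)) k i) = (\<Sum>i<3 * N. q i * sq_row E V (m + k) i)"
      unfolding sum_sq_row using form_shift[OF q'_eq] by simp
    also have "\<dots> = 0" using q T that by auto
    finally show ?thesis .
  qed
  then have z: "q' i = 0" if "i < 3 * N" for i
    using nondegD[OF nd] that by (metis lessThan_iff)
  have "i div 3 < N" using i by auto
  then have "3 * (i div 3) < 3 * N" "3 * (i div 3) + 1 < 3 * N" "3 * (i div 3) + 2 < 3 * N"
    by linarith+
  then have "formX E q V m (i div 3) = 0" "formY E q V m (i div 3) = 0" "formZ E q V m (i div 3) = 0"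
    using q'_eq[of "i div 3"] z[of "3 * (i div 3)"] z[of "3 * (i div 3) + 1"] z[of "3 * (i div 3) + 2"]
    by auto
  note q0 = form_eq_0_imp[OF this]
  have "i = 3 * (i div 3) \<or> i = 3 * (i div 3) + 1 \<or> i = 3 * (i div 3) + 2" by presburger
  then show "q i = 0" using q0 by metis
qed

section \<open>Unisolvent point sets\<close>

lemma sum_scaled_apply:
  fixes c :: "'b \<Rightarrow> real"
  shows "(\<Sum>v\<in>B. (\<lambda>x. c v * f v x)) x = (\<Sum>v\<in>B. c v * f v x)"
  by (induction B rule: infinite_finite_induct) simp_all

text \<open>For a basis \<open>B\<close> with \<open>M\<close> elements, consider the values of the
  basis functions at \<open>M\<close> points, stored one after another in a single potential.
  Greedily chosen points make this square matrix nonsingular, and \<open>p\<close> is the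
  certificate from \<open>nondeg_open_condition\<close>. Where \<open>p\<close> is nonzero, a
  function in the span that vanishes at all \<open>M\<close> points is zero.\<close>

lemma unisolvent_generic:
  assumes "fin_gen L G"
  obtains M p where "p \<in> pol (M * L)" "\<exists>V. p V \<noteq> 0"
    "\<And>V f. p V \<noteq> 0 \<Longrightarrow> f \<in> G \<Longrightarrow> \<exists>U. f U \<noteq> 0 \<Longrightarrow> \<exists>n<M. f (\<lambda>l. V (n * L + l)) \<noteq> 0"
proof -
  obtain B where B: "finite B" "B \<subseteq> pol L" "fv.independent B" "G \<subseteq> fv.span B"
    using fin_gen_basis[OF assms] .
  define M where "M = card B"
  define w where "w n b V = b (\<lambda>l. V (n * L + l))" 
    for n and b :: "(nat \<Rightarrow> real) \<Rightarrow> real" and V :: "nat \<Rightarrow> real"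
  have "\<exists>V. nondeg ({..<card B} \<times> {()}) B (\<lambda>(n, k) b. (\<lambda>n k b V. w n b V) n k b V)"
  proof (rule nondeg_greedy[of B "{()}" L])
    fix n b and v v' :: "nat \<Rightarrow> real"
    assume b: "b \<in> B" and v: "\<And>l. l < Suc n * L \<Longrightarrow> v' l = v l"
    show "w n b v' = w n b v"
      unfolding w_def
    proof (rule pol_cong[of b L])
      show "b \<in> pol L" using b B by blast
      fix l assume "l < L"
      then show "v' (n * L + l) = v (n * L + l)" by (intro v) simp
    qed
  next
    fix n and v :: "nat \<Rightarrow> real" and q :: "((nat \<Rightarrow> real) \<Rightarrow> real) \<Rightarrow> real"
    assume q: "\<exists>b\<in>B. q b \<noteq> 0"
    have "(\<Sum>b\<in>B. (\<lambda>x. q b * b x)) \<noteq> 0"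
    proof
      assume "(\<Sum>b\<in>B. (\<lambda>x. q b * b x)) = 0"
      with q have "fv.dependent B"
        by (subst fv.dependent_finite[OF B(1)]) (intro exI[of _ q] conjI)
      then show False using B(3) by contradiction
    qed
    then obtain U where "(\<Sum>b\<in>B. (\<lambda>x. q b * b x)) U \<noteq> 0" by (auto simp: fun_eq_iff zero_fun_def)
    then have U: "(\<Sum>b\<in>B. q b * b U) \<noteq> 0"
      unfolding sum_scaled_apply .
    \<comment> \<open>The new block stores a point \<open>U\<close> where the given combination of
      basis functions is nonzero.\<close>
    let ?v = "\<lambda>l. if l < n * L then v l else U (l - n * L)"
    have "w n b ?v = b U" for b unfolding w_def by simp
    with U show "\<exists>v' k. (\<forall>l<n * L. v' l = v l) \<and> k \<in> {()} \<and> (\<Sum>b\<in>B. q b * w n b v') \<noteq> 0"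
      by (intro exI[of _ ?v]) simp
  qed (rule B(1))
  then obtain V0 where V0: "nondeg ({..<card B} \<times> {()}) B (\<lambda>(n, k) b. w n b V0)" by auto
  have V0': "nondeg {..<M} B (\<lambda>n b. w n b V0)"
    by (rule nondeg_rows[OF V0]) (auto simp: M_def)
  define F where "F = (\<lambda>(n, b). w n b) ` ({..<M} \<times> B)"
  have "F \<subseteq> pol (M * L)"
  proof -
    have "w n b \<in> pol (M * L)" if "n < M" "b \<in> B" for n b
      unfolding w_def
    proof (rule pol_compose[of b L])
      show "b \<in> pol L" using that B by blast
      fix l assume "l < L"
      then have "n * L + l < Suc n * L" by simp
      also have "Suc n * L \<le> M * L" using that by (intro mult_right_mono) auto
      finally show "(\<lambda>V. V (n * L + l)) \<in> pol (M * L)" by (rule pol_coord)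
    qed
    then show ?thesis by (auto simp: F_def)
  qed
  then have "fin_gen (M * L) F" using B(1) by (intro fin_gen_finite) (auto simp: F_def)
  from nondeg_open_condition[OF B(1) this, of "{..<M}"]
  obtain G' where G': "fin_gen (M * L) G'" "\<forall>w V0. (\<forall>k\<in>{..<M}. \<forall>i\<in>B. w k i \<in> F) \<longrightarrow>
    nondeg {..<M} B (\<lambda>k i. w k i V0) \<longrightarrow>
    (\<exists>p\<in>G'. p V0 \<noteq> 0 \<and> (\<forall>V. p V \<noteq> 0 \<longrightarrow> nondeg {..<M} B (\<lambda>k i. w k i V)))"
    by (elim exE conjE)
  have "\<forall>k\<in>{..<M}. \<forall>i\<in>B. w k i \<in> F" by (auto simp: F_def)
  from G'(2)[THEN spec, of w, THEN spec, of V0, THEN mp, OF this, THEN mp, OF V0'] obtain p where p: "p \<in> G'" "p V0 \<noteq> 0"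
    "\<And>V. p V \<noteq> 0 \<Longrightarrow> nondeg {..<M} B (\<lambda>n b. w n b V)"
    by blast
  show ?thesis
  proof (rule that[of p M])
    show "p \<in> pol (M * L)"
      using p(1) G'(1) span_pol unfolding fin_gen_def by blast
    show "\<exists>V. p V \<noteq> 0" using p(2) by blast
    fix V f assume V: "p V \<noteq> 0" and f: "f \<in> G" "\<exists>U. f U \<noteq> 0"
    have "f \<in> fv.span B" using f(1) B(4) by blast
    then obtain c where "f = (\<Sum>b\<in>B. (\<lambda>x. c b * b x))"
      unfolding fv.span_finite[OF B(1)] by blast
    then have c: "f U = (\<Sum>b\<in>B. c b * b U)" for U by (simp add: sum_scaled_apply)
    show "\<exists>n<M. f (\<lambda>l. V (n * L + l)) \<noteq> 0"
    proof (rule ccontr)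
      assume "\<not> ?thesis"
      then have "(\<Sum>b\<in>B. c b * w n b V) = 0" if "n < M" for n
        using that by (simp add: c w_def)
      then have "c b = 0" if "b \<in> B" for b
        using nondegD[OF p(3)[OF V]] that by (metis lessThan_iff)
      then show False using f(2) by (simp add: c)
    qed
  qed
qed

section \<open>Genericity of the nonvanishing set of a polynomial\<close>

lemma pol_mono:
  assumes "f \<in> pol T" "T \<le> T'"
  shows "f \<in> pol T'"
  using assms(1) by induction (use assms(2) in \<open>auto intro: pol.intros\<close>)

text \<open>The set is open, so only density is at stake. On the line from any \<open>V\<close> to a
  point where \<open>p\<close> is nonzero, \<open>p\<close> has finitely many zeros, so nonzero
  values occur arbitrarily close to \<open>V\<close>.\<close>

lemma baire_generic_pol_nonzero:
  assumes p: "p \<in> pol T" "p V0 \<noteq> 0"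
  shows "baire_generic (Euclidean_space T) {V \<in> topspace (Euclidean_space T). p V \<noteq> 0}"
    (is "baire_generic ?X ?S")
  unfolding baire_generic_def
proof (intro conjI exI[of _ ?S])
  have X: "?X = subtopology euclidean (topspace ?X)"
    by (simp add: Euclidean_space_def euclidean_product_topology)
  have "open {V. p V \<noteq> 0}"
    using open_Collect_neq[OF pol_continuous[OF p(1)] continuous_on_const] .
  then have "openin ?X ?S"
    by (subst X, subst openin_open) auto
  then show "gdelta_in ?X ?S" by (rule open_imp_gdelta_in)
  show "?X closure_of ?S = topspace ?X"
  proof (intro equalityI subsetI)
    fix V assume V: "V \<in> topspace ?X"
    \<comment> \<open>Cutting \<open>V0\<close> off at \<open>T\<close> keeps the line inside the
      space and does not change the value of \<open>p\<close>.\<close>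
    define V1 where "V1 k = (if k < T then V0 k else 0)" for k
    define \<gamma> where "\<gamma> t = (\<lambda>k. V k + t * (V1 k - V k))" for t :: real
    have "p V1 \<noteq> 0" using pol_cong[OF p(1), of V0 V1] p(2) by (simp add: V1_def)
    obtain r where r: "\<And>t. p (\<gamma> t) = poly r t"
      using pol_line[OF p(1)] unfolding \<gamma>_def by blast
    have "poly r 1 \<noteq> 0" using \<open>p V1 \<noteq> 0\<close> r[of 1] by (simp add: \<gamma>_def)
    then have "r \<noteq> 0" by auto
    have \<gamma>X: "\<gamma> t \<in> topspace ?X" for t
      using V by (simp add: topspace_Euclidean_space \<gamma>_def V1_def)
    show "V \<in> ?X closure_of ?S"
      unfolding in_closure_of
    proof (intro conjI V allI impI)
      fix U assume U: "V \<in> U \<and> openin ?X U"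
      then obtain W where W: "open W" "U = topspace ?X \<inter> W"
        using openin_open[of "topspace ?X" U] X by metis
      have "continuous_on UNIV \<gamma>"
        unfolding \<gamma>_def
        by (intro continuous_on_coordinatewise_then_product continuous_intros)
      then have "open (\<gamma> -` W)" using W(1) by (metis open_vimage)
      moreover have "0 \<in> \<gamma> -` W" using U W by (simp add: \<gamma>_def)
      ultimately obtain e where e: "e > 0" "ball 0 e \<subseteq> \<gamma> -` W"
        using open_contains_ball by blast
      have "infinite (ball (0::real) e)" using e(1) by (simp add: ball_eq_greaterThanLessThan)
      then have "\<not> ball 0 e \<subseteq> {t. poly r t = 0}"
        using poly_roots_finite[OF \<open>r \<noteq> 0\<close>] finite_subset by blast
      then obtain t where "t \<in> ball 0 e" "poly r t \<noteq> 0" by blast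
      then have "\<gamma> t \<in> ?S" "\<gamma> t \<in> U" using e(2) \<gamma>X r W by auto
      then show "\<exists>y. y \<in> ?S \<and> y \<in> U" by blast
    qed
  qed (simp add: closure_of_def)
qed auto

section \<open>Transfer matrices relative to a base potential\<close>

lemma matrix_2_eqI:
  fixes A B :: "real^2^2"
  assumes "A $ 1 $ 1 = B $ 1 $ 1" "A $ 1 $ 2 = B $ 1 $ 2" "A $ 2 $ 1 = B $ 2 $ 1" "A $ 2 $ 2 = B $ 2 $ 2"
  shows "A = B"
  using assms by (simp add: vec_eq_iff forall_2)

lemma det_transfer: "det (transfer k e V) = 1"
proof (induction k)
  case (Suc k)
  have "det (Amat (e - V k)) = 1" by (simp add: det_2)
  then show ?case using Suc by (simp add: det_mul)
qed simp

definition adj2 :: "real^2^2 \<Rightarrow> real^2^2" where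
  "adj2 A = vector [vector [A $ 2 $ 2, - A $ 1 $ 2], vector [- A $ 2 $ 1, A $ 1 $ 1]]"

lemma adj2_mult:
  assumes "det A = 1"
  shows "adj2 A ** A = mat 1" "A ** adj2 A = mat 1"
  using assms by (intro matrix_2_eqI; simp add: adj2_def matrix_mult_2 mat_def det_2 algebra_simps)+

text \<open>This is \<open>- M\<inverse> A\<inverse> e\<^sub>1\<^sub>1 M\<close> for \<open>A = Amat t\<close>, which does not depend on \<open>t\<close>.\<close>

definition nil2 :: "real^2^2 \<Rightarrow> real^2^2" where
  "nil2 M = vector [vector [- (M $ 1 $ 1 * M $ 1 $ 2), - (M $ 1 $ 2)\<^sup>2],
                    vector [(M $ 1 $ 1)\<^sup>2, M $ 1 $ 1 * M $ 1 $ 2]]"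

text \<open>With \<open>w k = nil2 (transfer k e c)\<close> this is the inverse of
  \<open>transfer k e c\<close> times \<open>transfer k e V\<close>, written as a product with one
  factor for each potential value.\<close>

primrec rel_transfer :: "(nat \<Rightarrow> real^2^2) \<Rightarrow> (nat \<Rightarrow> real) \<Rightarrow> nat \<Rightarrow> (nat \<Rightarrow> real) \<Rightarrow> real^2^2" where
  "rel_transfer w c 0 V = mat 1"
| "rel_transfer w c (Suc k) V = (mat 1 + (V k - c k) *\<^sub>R w k) ** rel_transfer w c k V"

lemma Amat_perturb:
  assumes "det M = 1"
  shows "Amat (t - d) ** M = Amat t ** M ** (mat 1 + d *\<^sub>R nil2 M)"
proof -
  have 1: "M $ 1 $ 1 * M $ 2 $ 2 = 1 + M $ 1 $ 2 * M $ 2 $ 1" using assms by (simp add: det_2)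
  \<comment> \<open>\<open>Amat t ** D\<close> is minus the matrix with first row
    \<open>M $ 1\<close> and second row zero, for every \<open>t\<close>. This is the change of
    \<open>Amat t ** M\<close> when \<open>t\<close> decreases by one.\<close>
  define D :: "real^2^2" where "D = vector [vector [0, 0], M $ 1]"
  have D: "D $ 1 $ 1 = 0" "D $ 1 $ 2 = 0" "D $ 2 = M $ 1" by (simp_all add: D_def)
  have "M ** nil2 M = D"
  proof (rule matrix_2_eqI)
    have "(M ** nil2 M) $ 2 $ 1 = M $ 1 $ 1 * (M $ 1 $ 1 * M $ 2 $ 2 - M $ 1 $ 2 * M $ 2 $ 1)"
      "(M ** nil2 M) $ 2 $ 2 = M $ 1 $ 2 * (M $ 1 $ 1 * M $ 2 $ 2 - M $ 1 $ 2 * M $ 2 $ 1)"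
      by (simp_all add: matrix_mult_2 nil2_def power2_eq_square algebra_simps)
    then show "(M ** nil2 M) $ 2 $ 1 = D $ 2 $ 1"
      "(M ** nil2 M) $ 2 $ 2 = D $ 2 $ 2"
      using 1 by (simp_all add: D)
  qed (simp_all add: D matrix_mult_2 nil2_def power2_eq_square algebra_simps)
  have "Amat t ** M ** (mat 1 + d *\<^sub>R nil2 M) = Amat t ** M + d *\<^sub>R (Amat t ** (M ** nil2 M))"
    by (rule matrix_2_eqI) (simp_all add: matrix_mult_2 mat_def algebra_simps)
  also note \<open>M ** nil2 M = _\<close>
  also have "Amat t ** M + d *\<^sub>R (Amat t ** D) = Amat (t - d) ** M"
    by (rule matrix_2_eqI) (simp_all add: D matrix_mult_2 algebra_simps)
  finally show ?thesis by simp
qed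

lemma transfer_eq_rel_transfer:
  "transfer k e V = transfer k e c ** rel_transfer (\<lambda>k. nil2 (transfer k e c)) c k V"
proof (induction k)
  case (Suc k)
  have "transfer (Suc k) e V = Amat ((e - c k) - (V k - c k)) ** transfer k e V" by simp
  also have "\<dots> = Amat (e - c k) ** transfer k e c **
      (mat 1 + (V k - c k) *\<^sub>R nil2 (transfer k e c)) **
      rel_transfer (\<lambda>k. nil2 (transfer k e c)) c k V"
    unfolding Amat_perturb[OF det_transfer, symmetric] by (simp add: Suc matrix_mul_assoc)
  finally show ?case by (simp add: matrix_mul_assoc)
qed simp

section \<open>Strict differentiability at the base potential\<close>

lemma matrix_mult_norm_bound:
  obtains K where "K > 0" "\<And>(A :: real^2^2) (B :: real^2^2). norm (A ** B) \<le> norm A * norm B * K"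
proof -
  have "bilinear ((**) :: real^2^2 \<Rightarrow> real^2^2 \<Rightarrow> real^2^2)"
    unfolding bilinear_def
    by (intro conjI allI linearI matrix_2_eqI) (simp_all add: matrix_mult_2 algebra_simps)
  then have "bounded_bilinear ((**) :: real^2^2 \<Rightarrow> real^2^2 \<Rightarrow> real^2^2)"
    by (simp add: bilinear_conv_bounded_bilinear)
  from bounded_bilinear.pos_bounded[OF this]
  obtain K where "K > 0" "\<forall>(A :: real^2^2) (B :: real^2^2). norm (A ** B) \<le> norm A * norm B * K"
    by metis
  then show ?thesis by (intro that[of K]) simp_all
qed

lemma rel_transfer_base: "rel_transfer w c k c = mat 1"
  by (induction k) simp_all

text \<open>The estimate compares two arbitrary points near \<open>c\<close>, not just a point with
  \<open>c\<close>; this strict form of differentiability is what yields local injectivity. The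
  induction applies the product rule to the last factor.\<close>

lemma rel_transfer_strict_diff:
  assumes "\<epsilon> > 0"
  shows "\<exists>\<delta>>0. \<forall>x y. (\<forall>l<k. \<bar>x l - c l\<bar> < \<delta> \<and> \<bar>y l - c l\<bar> < \<delta>) \<longrightarrow>
    norm (rel_transfer w c k x - rel_transfer w c k y - (\<Sum>l<k. (x l - y l) *\<^sub>R w l))
      \<le> \<epsilon> * (\<Sum>l<k. \<bar>x l - y l\<bar>)"
  using assms
proof (induction k arbitrary: \<epsilon>)
  case 0
  then show ?case by (auto intro: exI[of _ 1])
next
  case (Suc k)
  let ?G = "rel_transfer w c"
  obtain K where K: "K > 0" "\<And>(A :: real^2^2) (B :: real^2^2). norm (A ** B) \<le> norm A * norm B * K"
    using matrix_mult_norm_bound by blast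
  \<comment> \<open>\<open>S\<close> will be a Lipschitz constant of \<open>?G k\<close> near
    \<open>c\<close>, obtained from the induction hypothesis with error constant 1. \<open>C\<close>
    then bounds the effect of multiplying by \<open>w k\<close>.\<close>
  define S where "S = 1 + (\<Sum>l<k. norm (w l))"
  have "S > 0" unfolding S_def by (intro add_pos_nonneg sum_nonneg) auto
  define C where "C = norm (w k) * K * S"
  have "C \<ge> 0" using K \<open>S > 0\<close> by (simp add: C_def)
  obtain d1 where d1: "d1 > 0" "\<And>x y. (\<forall>l<k. \<bar>x l - c l\<bar> < d1 \<and> \<bar>y l - c l\<bar> < d1) \<Longrightarrow>
      norm (?G k x - ?G k y - (\<Sum>l<k. (x l - y l) *\<^sub>R w l)) \<le> \<epsilon> / 2 * (\<Sum>l<k. \<bar>x l - y l\<bar>)"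
    using Suc.IH[of "\<epsilon> / 2"] Suc.prems by auto
  obtain d2 where d2: "d2 > 0" "\<And>x y. (\<forall>l<k. \<bar>x l - c l\<bar> < d2 \<and> \<bar>y l - c l\<bar> < d2) \<Longrightarrow>
      norm (?G k x - ?G k y - (\<Sum>l<k. (x l - y l) *\<^sub>R w l)) \<le> 1 * (\<Sum>l<k. \<bar>x l - y l\<bar>)"
    using Suc.IH[of 1] by auto
  define P where "P = (C + 1) * (real k + 1)"
  have "P > 0" using \<open>C \<ge> 0\<close> by (simp add: P_def)
  define d3 where "d3 = \<epsilon> / (2 * P)"
  have "d3 > 0" using Suc.prems \<open>P > 0\<close> by (simp add: d3_def)
  have Cd3: "C * (real k * d3) \<le> \<epsilon>" "C * d3 \<le> \<epsilon> / 2"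
  proof -
    have "P * d3 = \<epsilon> / 2" using \<open>P > 0\<close> by (simp add: d3_def)
    then have *: "(C + 1) * ((real k + 1) * d3) = \<epsilon> / 2" by (simp only: P_def mult.assoc)
    have "C * (real k * d3) \<le> (C + 1) * ((real k + 1) * d3)" "C * d3 \<le> (C + 1) * ((real k + 1) * d3)"
      using \<open>C \<ge> 0\<close> \<open>d3 > 0\<close> by (intro mult_mono; simp)+
    then show "C * (real k * d3) \<le> \<epsilon>" "C * d3 \<le> \<epsilon> / 2" using * Suc.prems by simp_all
  qed
  show ?case
  proof (intro exI[of _ "min d1 (min d2 d3)"] conjI allI impI)
    show "min d1 (min d2 d3) > 0" using d1 d2 \<open>d3 > 0\<close> by simp
    fix x y assume xy: "\<forall>l<Suc k. \<bar>x l - c l\<bar> < min d1 (min d2 d3) \<and> \<bar>y l - c l\<bar> < min d1 (min d2 d3)"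
    have lip: "norm (w k ** (?G k x - ?G k y)) \<le> C * (\<Sum>l<k. \<bar>x l - y l\<bar>)"
      if "\<forall>l<k. \<bar>x l - c l\<bar> < d2 \<and> \<bar>y l - c l\<bar> < d2" for x y
    proof -
      have "norm (\<Sum>l<k. (x l - y l) *\<^sub>R w l) \<le> (\<Sum>l<k. \<bar>x l - y l\<bar> * norm (w l))"
        by (rule order_trans[OF norm_sum]) simp
      also have "\<dots> \<le> (\<Sum>l<k. \<bar>x l - y l\<bar> * (S - 1))"
        unfolding S_def by (intro sum_mono mult_left_mono) (auto intro: member_le_sum)
      finally have "norm (\<Sum>l<k. (x l - y l) *\<^sub>R w l) \<le> (\<Sum>l<k. \<bar>x l - y l\<bar>) * (S - 1)"
        by (simp add: sum_distrib_right)
      then have "norm (?G k x - ?G k y) \<le> (\<Sum>l<k. \<bar>x l - y l\<bar>) * S"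
        using d2(2)[OF that] norm_triangle_sub[of "?G k x - ?G k y" "\<Sum>l<k. (x l - y l) *\<^sub>R w l"]
        by (simp add: algebra_simps)
      then have "norm (w k) * norm (?G k x - ?G k y) * K \<le> norm (w k) * ((\<Sum>l<k. \<bar>x l - y l\<bar>) * S) * K"
        using K(1) by (intro mult_right_mono mult_left_mono) auto
      with K(2)[of "w k" "?G k x - ?G k y"] show ?thesis
        by (simp add: C_def mult_ac)
    qed
    have "norm (w k ** (?G k x - mat 1)) \<le> C * (\<Sum>l<k. \<bar>x l - c l\<bar>)"
      using lip[of x c] xy d2(1) by (simp add: rel_transfer_base)
    also have "\<dots> \<le> C * (\<Sum>l<k. d3)"
      using xy \<open>C \<ge> 0\<close> by (intro mult_left_mono sum_mono) (auto intro: less_imp_le)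
    also have "\<dots> \<le> \<epsilon>" using Cd3(1) by simp
    finally have t2: "norm ((x k - y k) *\<^sub>R (w k ** (?G k x - mat 1))) \<le> \<bar>x k - y k\<bar> * \<epsilon>"
      by (simp add: mult_left_mono)
    have "norm ((y k - c k) *\<^sub>R (w k ** (?G k x - ?G k y))) \<le> d3 * (C * (\<Sum>l<k. \<bar>x l - y l\<bar>))"
      using lip[of x y] xy by (auto intro!: mult_mono less_imp_le[of "\<bar>y k - c k\<bar>"] simp del: mult_minus_left)
    also have "\<dots> = (C * d3) * (\<Sum>l<k. \<bar>x l - y l\<bar>)" by simp
    also have "\<dots> \<le> \<epsilon> / 2 * (\<Sum>l<k. \<bar>x l - y l\<bar>)"
      using Cd3(2) by (intro mult_right_mono sum_nonneg) auto
    finally have t3: "norm ((y k - c k) *\<^sub>R (w k ** (?G k x - ?G k y))) \<le> \<epsilon> / 2 * (\<Sum>l<k. \<bar>x l - y l\<bar>)" .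
    have t1: "norm (?G k x - ?G k y - (\<Sum>l<k. (x l - y l) *\<^sub>R w l)) \<le> \<epsilon> / 2 * (\<Sum>l<k. \<bar>x l - y l\<bar>)"
      using xy by (intro d1(2)) auto
    \<comment> \<open>Product rule: the second summand is small since \<open>?G k x\<close> is near
      \<open>mat 1\<close>, the third since \<open>y k\<close> is near \<open>c k\<close>.\<close>
    have "?G (Suc k) x - ?G (Suc k) y - (\<Sum>l<Suc k. (x l - y l) *\<^sub>R w l)
      = (?G k x - ?G k y - (\<Sum>l<k. (x l - y l) *\<^sub>R w l))
        + (x k - y k) *\<^sub>R (w k ** (?G k x - mat 1)) + (y k - c k) *\<^sub>R (w k ** (?G k x - ?G k y))"
      by (rule matrix_2_eqI) (simp_all add: matrix_mult_2 mat_def algebra_simps)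
    also have "norm \<dots> \<le> \<epsilon> / 2 * (\<Sum>l<k. \<bar>x l - y l\<bar>) + \<bar>x k - y k\<bar> * \<epsilon> + \<epsilon> / 2 * (\<Sum>l<k. \<bar>x l - y l\<bar>)"
      by (intro order_trans[OF norm_triangle_ineq] add_mono t1 t2 t3)
    also have "\<dots> = \<epsilon> * (\<Sum>l<Suc k. \<bar>x l - y l\<bar>)" by (simp add: algebra_simps)
    finally show "norm (?G (Suc k) x - ?G (Suc k) y - (\<Sum>l<Suc k. (x l - y l) *\<^sub>R w l))
      \<le> \<epsilon> * (\<Sum>l<Suc k. \<bar>x l - y l\<bar>)" .
  qed
qed

section \<open>From nondegeneracy to openness\<close>

text \<open>The signs are chosen such that \<open>chart i\<close> maps the derivative \<open>nil2\<close> to \<open>sq_row\<close>. The fourth entry of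
  a matrix near the identity is determined by these three and the determinant.\<close>

definition chart :: "nat \<Rightarrow> real^2^2 \<Rightarrow> real" where
  "chart i A = (if i mod 3 = 0 then A $ 2 $ 1 else if i mod 3 = 1 then - A $ 1 $ 1 else - A $ 1 $ 2)"

lemma linear_chart: "linear (chart i)"
  by (intro linearI) (simp_all add: chart_def)

lemma abs_chart_le: "\<bar>chart i A\<bar> \<le> norm A"
proof -
  have "\<bar>A $ r $ s\<bar> \<le> norm A" for r s
    using component_le_norm_cart[of "A $ r" s] Finite_Cartesian_Product.norm_nth_le[of A r] by simp
  then show ?thesis by (simp add: chart_def)
qed

lemma continuous_on_chart: "continuous_on S (chart i)"
  by (intro linear_continuous_on linear_conv_bounded_linear[THEN iffD1] linear_chart)

lemma chart_nil2: "chart i (nil2 (transfer k (E (i div 3)) V)) = sq_row E V k i"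
  by (simp add: chart_def nil2_def sq_row_def Let_def)

lemma chart_inj:
  assumes det: "det A = 1" "det B = 1" and pos: "B $ 1 $ 1 > 0"
    and eq: "\<And>r. r < 3 \<Longrightarrow> chart (3 * j + r) A = chart (3 * j + r) B"
  shows "A = B"
proof -
  have m: "3 * j mod 3 = 0" "(3 * j + 1) mod 3 = 1" "(3 * j + 2) mod 3 = 2" by presburger+
  have e: "A $ 2 $ 1 = B $ 2 $ 1" "A $ 1 $ 1 = B $ 1 $ 1" "A $ 1 $ 2 = B $ 1 $ 2"
    using eq[of 0] eq[of 1] eq[of 2] m by (simp_all add: chart_def)
  have "B $ 1 $ 1 * A $ 2 $ 2 = B $ 1 $ 1 * B $ 2 $ 2"
    using det unfolding det_2 e by linarith
  then show ?thesis using e pos by (intro matrix_2_eqI) auto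
qed

lemma rel_transfer_pol:
  "k \<le> T \<Longrightarrow> (\<lambda>V. rel_transfer w c k V $ i $ j) \<in> pol T"
proof (induction k arbitrary: i)
  case 0
  then show ?case by (simp add: pol_const)
next
  case (Suc k)
  have a: "(\<lambda>V. (mat 1 + (V k - c k) *\<^sub>R w k) $ r $ s) \<in> pol T" for r s
  proof -
    have "(\<lambda>V. (mat 1 $ r $ s - c k * w k $ r $ s) + V k * w k $ r $ s) \<in> pol T"
      using Suc.prems by (intro pol.intros) simp_all
    then show ?thesis by (simp add: algebra_simps)
  qed
  show ?case
    unfolding rel_transfer.simps matrix_mult_2 using Suc.prems by (intro pol_add pol_mult a Suc.IH) simp_all
qed

lemma det_rel_transfer:
  "det (rel_transfer (\<lambda>k. nil2 (transfer k e c)) c k V) = 1"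
proof -
  have "det (transfer k e c) * det (rel_transfer (\<lambda>k. nil2 (transfer k e c)) c k V) = 1"
    using det_transfer[of k e V] unfolding transfer_eq_rel_transfer[of k e V c] det_mul .
  then show ?thesis by (simp add: det_transfer)
qed

text \<open>The potential is restricted to a slice of dimension \<open>3 * N\<close> through
  \<open>V\<close> on which the derivative in the chart is the identity. Strict differentiability
  makes the restricted map injective near the base point, invariance of domain makes its image open,
  and the chart carries this back to \<open>SL2_power N\<close>.\<close>

lemma nondeg_imp_open_map_at:
  assumes V: "V \<in> topspace (Euclidean_space T)"
    and nd: "nondeg {..<T} {..<3 * N} (sq_row E V)"
  shows "open_map_at (Euclidean_space T) (SL2_power N) (Phi N T E) V"
  unfolding open_map_at_def
proof (intro allI impI)
  fix U assume U: "U \<subseteq> topspace (Euclidean_space T)" "V \<in> Euclidean_space T interior_of U"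
  have ES: "Euclidean_space n = subtopology euclidean (topspace (Euclidean_space n))" for n
    by (simp add: Euclidean_space_def euclidean_product_topology)
  have open_iff: "openin (Euclidean_space n) X \<longleftrightarrow>
      (\<exists>W. open W \<and> X = topspace (Euclidean_space n) \<inter> W)" for n X
    by (subst ES) (rule openin_open)
  obtain W0 where "openin (Euclidean_space T) W0" "V \<in> W0" "W0 \<subseteq> U"
    using U(2) unfolding interior_of_def by auto
  moreover from this obtain W where "open W" "W0 = topspace (Euclidean_space T) \<inter> W"
    unfolding open_iff by (elim exE conjE)
  ultimately have W: "open W" "V \<in> W" "topspace (Euclidean_space T) \<inter> W \<subseteq> U" by auto
  define G where "G j V' = rel_transfer (\<lambda>k. nil2 (transfer k (E j) V)) V T V'" for j V'
  define F where "F V' i = chart i (G (i div 3) V')" for V' i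
  obtain R where R: "\<And>i j. i \<in> {..<3 * N} \<Longrightarrow>
      (\<Sum>k<T. R k j * sq_row E V k i) = (if i = j then 1 else 0)"
    using nondeg_right_inverse[OF finite_lessThan finite_lessThan nd] by metis
  \<comment> \<open>The slice: moving by \<open>x\<close> along the right inverse \<open>R\<close>
    changes the chart coordinates by \<open>x\<close> to first order.\<close>
  define s where "s x k = V k + (if k < T then \<Sum>i<3 * N. R k i * x i else 0)" for x :: "nat \<Rightarrow> real" and k
  define g where "g x i = (if i < 3 * N then F (s x) i else 0)" for x i
  define C where "C = (\<Sum>k<T. \<Sum>i<3 * N. \<bar>R k i\<bar>)"
  have "C \<ge> 0" unfolding C_def by (intro sum_nonneg) auto
  \<comment> \<open>In the sum norms \<open>C\<close> is a Lipschitz constant of \<open>s\<close>.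
    The choice gives \<open>real (3 * N) * C * \<epsilon> \<le> 1 / 2\<close>, which makes the error
    a contraction.\<close>
  define \<epsilon> where "\<epsilon> = 1 / (2 * (real (3 * N) * C + 1))"
  have pos: "real (3 * N) * C + 1 > 0" using \<open>C \<ge> 0\<close> by (intro add_nonneg_pos mult_nonneg_nonneg) auto
  then have "\<epsilon> > 0" by (simp add: \<epsilon>_def)
  have "\<forall>j. \<exists>\<delta>>0. \<forall>x y. (\<forall>l<T. \<bar>x l - V l\<bar> < \<delta> \<and> \<bar>y l - V l\<bar> < \<delta>) \<longrightarrow>
    norm (G j x - G j y - (\<Sum>l<T. (x l - y l) *\<^sub>R nil2 (transfer l (E j) V)))
      \<le> \<epsilon> * (\<Sum>l<T. \<bar>x l - y l\<bar>)"
    unfolding G_def by (intro allI rel_transfer_strict_diff \<open>\<epsilon> > 0\<close>)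
  from choice[OF this] obtain \<delta> where \<delta>': "\<forall>j. \<delta> j > 0 \<and>
    (\<forall>x y. (\<forall>l<T. \<bar>x l - V l\<bar> < \<delta> j \<and> \<bar>y l - V l\<bar> < \<delta> j) \<longrightarrow>
    norm (G j x - G j y - (\<Sum>l<T. (x l - y l) *\<^sub>R nil2 (transfer l (E j) V)))
      \<le> \<epsilon> * (\<Sum>l<T. \<bar>x l - y l\<bar>))" by (elim exE)
  then have \<delta>: "\<delta> j > 0" "(\<forall>l<T. \<bar>x l - V l\<bar> < \<delta> j \<and> \<bar>y l - V l\<bar> < \<delta> j) \<Longrightarrow>
    norm (G j x - G j y - (\<Sum>l<T. (x l - y l) *\<^sub>R nil2 (transfer l (E j) V)))
      \<le> \<epsilon> * (\<Sum>l<T. \<bar>x l - y l\<bar>)" for j x y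
    by simp_all
  \<comment> \<open>Positivity of the upper left entry is included because there the chart
    determines a matrix of determinant 1.\<close>
  define W' where "W' = W \<inter> (\<Inter>j<N. \<Inter>l<T. {V'. \<bar>V' l - V l\<bar> < \<delta> j}) \<inter> (\<Inter>j<N. {V'. 0 < G j V' $ 1 $ 1})"
  define P where "P = {x \<in> topspace (Euclidean_space (3 * N)). s x \<in> W'}"
  have Gcont: "continuous_on UNIV (\<lambda>V'. G j V' $ r $ t)" for j r t
    unfolding G_def by (rule pol_continuous[OF rel_transfer_pol[OF order_refl]])
  have Gcont': "continuous_on UNIV (G j)" for j
  proof -
    have "continuous_on UNIV (\<lambda>V'. \<chi> r t. G j V' $ r $ t)"
      by (intro continuous_on_vec_lambda Gcont)
    then show ?thesis by simp
  qed
  have scont: "continuous_on UNIV s"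
  proof (rule continuous_on_coordinatewise_then_product)
    fix k
    have "continuous_on UNIV (\<lambda>x. V k + (\<Sum>i<3 * N. R k i * x i))"
      by (intro continuous_on_add continuous_on_const continuous_on_sum continuous_on_mult
          continuous_on_product_coordinates)
    then show "continuous_on UNIV (\<lambda>x. s x k)"
      by (cases "k < T") (simp_all add: s_def)
  qed
  have "open W'"
    unfolding W'_def using W(1)
    by (intro open_Int open_INT finite_lessThan ballI open_Collect_less Gcont)
      (auto intro!: continuous_intros continuous_on_product_coordinates)
  then have "open (s -` W')" using scont by (metis open_vimage)
  then have openP: "openin (Euclidean_space (3 * N)) P"
    unfolding open_iff by (intro exI[of _ "s -` W'"]) (auto simp: P_def)
  have s0: "s (\<lambda>_. 0) = V" by (rule ext) (simp add: s_def)
  have G0: "G j V = mat 1" for j by (simp add: G_def rel_transfer_base)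
  have "V \<in> W'" using W(2) \<delta>(1) by (auto simp: W'_def G0 mat_def)
  then have "(\<lambda>_. 0) \<in> P" by (simp add: P_def s0 topspace_Euclidean_space)
  have "continuous_map (Euclidean_space (3 * N)) (Euclidean_space (3 * N)) g"
    unfolding g_def[abs_def] continuous_map_componentwise_Euclidean_space
  proof (intro allI impI)
    fix i
    have "continuous_on UNIV (\<lambda>x. F (s x) i)"
      unfolding F_def
      using continuous_on_compose2[OF continuous_on_chart[of UNIV i]
          continuous_on_compose2[OF Gcont' scont]] by simp
    then show "continuous_map (Euclidean_space (3 * N)) euclideanreal (\<lambda>x. F (s x) i)"
      unfolding continuous_map_Euclidean_space_iff using continuous_on_subset by blast
  qed
  then have contg: "continuous_map (subtopology (Euclidean_space (3 * N)) P) (Euclidean_space (3 * N)) g"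
    by (rule continuous_map_from_subtopology)
  have "inj_on g P"
  proof (rule inj_onI)
    fix x y assume xy: "x \<in> P" "y \<in> P" "g x = g y"
    define D where "D = (\<Sum>i<3 * N. \<bar>x i - y i\<bar>)"
    have "D \<ge> 0" unfolding D_def by (intro sum_nonneg) auto
    have sd: "s x k - s y k = (\<Sum>i<3 * N. R k i * (x i - y i))" if "k < T" for k
      using that by (simp add: s_def right_diff_distrib sum_subtractf)
    have sD: "(\<Sum>k<T. \<bar>s x k - s y k\<bar>) \<le> C * D"
    proof -
      have "(\<Sum>k<T. \<bar>s x k - s y k\<bar>) \<le> (\<Sum>k<T. \<Sum>i<3 * N. \<bar>R k i\<bar> * D)"
      proof (rule sum_mono)
        fix k assume "k \<in> {..<T}"
        then have "\<bar>s x k - s y k\<bar> \<le> (\<Sum>i<3 * N. \<bar>R k i * (x i - y i)\<bar>)"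
          by (simp add: sd)
        also have "\<dots> \<le> (\<Sum>i<3 * N. \<bar>R k i\<bar> * D)"
          unfolding abs_mult D_def by (intro sum_mono mult_left_mono member_le_sum) auto
        finally show "\<bar>s x k - s y k\<bar> \<le> (\<Sum>i<3 * N. \<bar>R k i\<bar> * D)" .
      qed
      then show ?thesis by (simp add: C_def sum_distrib_right)
    qed
    \<comment> \<open>When \<open>g x = g y\<close>, the strict estimate has only the linear part
      left, and this is \<open>x i - y i\<close>. Summing over \<open>i\<close> gives
      \<open>D \<le> D / 2\<close>.\<close>
    have "\<bar>x i - y i\<bar> \<le> \<epsilon> * (C * D)" if i: "i < 3 * N" for i
    proof -
      let ?j = "i div 3"
      have j: "?j < N" using i by auto
      let ?w = "\<lambda>l. nil2 (transfer l (E ?j) V)"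
      have "norm (G ?j (s x) - G ?j (s y) - (\<Sum>l<T. (s x l - s y l) *\<^sub>R ?w l))
          \<le> \<epsilon> * (\<Sum>l<T. \<bar>s x l - s y l\<bar>)"
        using xy(1,2) j by (intro \<delta>(2)) (auto simp: P_def W'_def)
      also have "\<dots> \<le> \<epsilon> * (C * D)" using sD \<open>\<epsilon> > 0\<close> by (intro mult_left_mono) auto
      finally have le: "\<bar>chart i (G ?j (s x) - G ?j (s y) - (\<Sum>l<T. (s x l - s y l) *\<^sub>R ?w l))\<bar> \<le> \<epsilon> * (C * D)"
        using abs_chart_le order_trans by blast
      have "chart i (\<Sum>l<T. (s x l - s y l) *\<^sub>R ?w l) = (\<Sum>l<T. (s x l - s y l) * sq_row E V l i)"
        by (simp add: linear_sum[OF linear_chart] linear_cmul[OF linear_chart] chart_nil2)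
      also have "\<dots> = (\<Sum>l<T. \<Sum>m<3 * N. R l m * (x m - y m) * sq_row E V l i)"
        by (intro sum.cong) (simp_all add: sd sum_distrib_right)
      also have "\<dots> = (\<Sum>m<3 * N. (x m - y m) * (\<Sum>l<T. R l m * sq_row E V l i))"
        by (subst sum.swap) (simp add: sum_distrib_left mult_ac)
      also have "\<dots> = (\<Sum>m<3 * N. if i = m then x m - y m else 0)"
        using R i by (intro sum.cong) auto
      also have "\<dots> = x i - y i" using i by simp
      finally have "chart i (\<Sum>l<T. (s x l - s y l) *\<^sub>R ?w l) = x i - y i" .
      moreover have "chart i (G ?j (s x)) = chart i (G ?j (s y))"
        using fun_cong[OF xy(3), of i] i by (simp add: g_def F_def)
      ultimately show ?thesis using le by (simp add: linear_diff[OF linear_chart])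
    qed
    then have "D \<le> (\<Sum>i<3 * N. \<epsilon> * (C * D))" unfolding D_def by (intro sum_mono) auto
    also have "\<dots> = (real (3 * N) * C * \<epsilon>) * D" by simp
    also have "\<dots> \<le> 1 / 2 * D"
      using pos \<open>D \<ge> 0\<close> by (intro mult_right_mono) (auto simp: \<epsilon>_def field_simps)
    finally have "D = 0" using \<open>D \<ge> 0\<close> by simp
    then have "x i = y i" if "i < 3 * N" for i
      using that unfolding D_def by (subst (asm) sum_nonneg_eq_0_iff) auto
    moreover have "x i = y i" if "i \<ge> 3 * N" for i
      using xy(1,2) that by (simp add: P_def topspace_Euclidean_space)
    ultimately show "x = y" by (meson ext not_le)
  qed
  then have opengP: "openin (Euclidean_space (3 * N)) (g ` P)"
    using invariance_of_domain_Euclidean_space[OF openP contg] by blast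
  \<comment> \<open>\<open>h\<close> reads off the chart coordinates of a tuple relative to the base
    transfer matrices, so that it sends \<open>Phi N T E (s x)\<close> to
    \<open>g x\<close>.\<close>
  define h where "h m i = (if i < 3 * N
      then chart i (adj2 (transfer T (E (i div 3)) V) ** m (i div 3)) else 0)"
    for m :: "nat \<Rightarrow> real^2^2" and i
  have "continuous_map (SL2_power N) (Euclidean_space (3 * N)) h"
    unfolding h_def[abs_def] continuous_map_componentwise_Euclidean_space
  proof (intro allI impI)
    fix i assume "i < 3 * N"
    then have "i div 3 \<in> {..<N}" by auto
    then have proj: "continuous_map (SL2_power N) (top_of_set SL2) (\<lambda>m. m (i div 3))"
      unfolding SL2_power_def by (rule continuous_map_product_projection)
    have "continuous_map (top_of_set SL2) euclideanreal
        (\<lambda>A. chart i (adj2 (transfer T (E (i div 3)) V) ** A))"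
    proof -
      have "linear (\<lambda>A. chart i (adj2 (transfer T (E (i div 3)) V) ** A))"
        by (intro linearI) (simp_all add: chart_def matrix_mult_2 algebra_simps)
      then show ?thesis
        by (simp add: linear_continuous_on linear_conv_bounded_linear)
    qed
    from continuous_map_compose[OF proj this] show "continuous_map (SL2_power N) euclideanreal
        (\<lambda>m. chart i (adj2 (transfer T (E (i div 3)) V) ** m (i div 3)))"
      by (simp add: o_def)
  qed
  then have op: "openin (SL2_power N) {m \<in> topspace (SL2_power N). h m \<in> g ` P}"
    using opengP by (rule openin_continuous_map_preimage)
  have ts: "topspace (SL2_power N) = (\<Pi>\<^sub>E j\<in>{..<N}. SL2)"
    by (simp add: SL2_power_def)
  have "Phi N T E V \<in> topspace (SL2_power N)"
    unfolding ts Phi_def by (auto simp: SL2_def det_transfer)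
  moreover have "h (Phi N T E V) = g (\<lambda>_. 0)"
  proof
    fix i show "h (Phi N T E V) i = g (\<lambda>_. 0) i"
    proof (cases "i < 3 * N")
      case True
      then have "i div 3 < N" by auto
      then show ?thesis
        by (simp add: h_def g_def Phi_def F_def s0 G0 adj2_mult det_transfer)
    qed (simp add: h_def g_def)
  qed
  ultimately have mem: "Phi N T E V \<in> {m \<in> topspace (SL2_power N). h m \<in> g ` P}"
    using \<open>(\<lambda>_. 0) \<in> P\<close> by auto
  have "{m \<in> topspace (SL2_power N). h m \<in> g ` P} \<subseteq> Phi N T E ` U"
  proof clarify
    fix m x assume m: "m \<in> topspace (SL2_power N)" "h m = g x" and x: "x \<in> P"
    \<comment> \<open>Equal chart coordinates suffice: both relative matrices have determinant 1 and
      the upper left entry of \<open>G j (s x)\<close> is positive.\<close>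
    have "m j = transfer T (E j) (s x)" if j: "j < N" for j
    proof -
      let ?M = "transfer T (E j) V"
      have dm: "det (m j) = 1" using m(1) j by (auto simp: ts SL2_def)
      have "det (adj2 ?M) * det ?M = 1"
        using adj2_mult(1)[OF det_transfer] by (metis det_I det_mul)
      then have "det (adj2 ?M ** m j) = 1" using dm by (simp add: det_mul det_transfer)
      moreover have "det (G j (s x)) = 1" unfolding G_def by (rule det_rel_transfer)
      moreover have "G j (s x) $ 1 $ 1 > 0" using x j by (auto simp: P_def W'_def)
      moreover have "chart (3 * j + r) (adj2 ?M ** m j) = chart (3 * j + r) (G j (s x))" if "r < 3" for r
      proof -
        have "3 * j + r < 3 * N" "(3 * j + r) div 3 = j" using j that by auto
        then show ?thesis using fun_cong[OF m(2), of "3 * j + r"] by (simp add: h_def g_def F_def)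
      qed
      ultimately have "adj2 ?M ** m j = G j (s x)" by (rule chart_inj)
      then have "?M ** (adj2 ?M ** m j) = ?M ** G j (s x)" by simp
      then show ?thesis
        unfolding matrix_mul_assoc adj2_mult(2)[OF det_transfer] matrix_mul_lid
        by (simp add: transfer_eq_rel_transfer[of T "E j" "s x" V] G_def)
    qed
    then have "m = Phi N T E (s x)"
      using m(1) unfolding ts Phi_def by (intro ext) (auto simp: PiE_def extensional_def)
    moreover have "s x \<in> topspace (Euclidean_space T)"
      using V by (simp add: topspace_Euclidean_space s_def)
    then have "s x \<in> U" using x W(3) by (auto simp: P_def W'_def)
    ultimately show "m \<in> Phi N T E ` U" by blast
  qed
  with mem op show "Phi N T E V \<in> SL2_power N interior_of (Phi N T E ` U)"
    unfolding interior_of_def by blast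
qed

theorem theorem2p1:
  fixes N :: nat
  assumes "N \<ge> 1"
  shows "\<exists>T::nat. T \<ge> 1 \<and>
    (\<exists>S. baire_generic (Euclidean_space T) S \<and> (\<forall>V\<in>S. malleable N T V))"
proof -
  define L where "L = 3 * N * (2 * N + 3)"
  obtain G where G: "fin_gen L G" "\<And>E. inj_on E {..<N} \<Longrightarrow>
     \<exists>p\<in>G. (\<exists>V. p V \<noteq> 0) \<and> (\<forall>V. p V \<noteq> 0 \<longrightarrow> nondeg {..<L} {..<3 * N} (sq_row E V))"
    unfolding L_def using nondeg_sq_row_generic[of N] by metis
  obtain M p V0 where p: "p \<in> pol (M * L)" "p V0 \<noteq> 0"
    "\<And>V f. p V \<noteq> 0 \<Longrightarrow> f \<in> G \<Longrightarrow> \<exists>U. f U \<noteq> 0 \<Longrightarrow> \<exists>n<M. f (\<lambda>l. V (n * L + l)) \<noteq> 0"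
    using unisolvent_generic[OF G(1)] by metis
  \<comment> \<open>The successor yields \<open>T \<ge> 1\<close> whatever \<open>M\<close> is; the
    blocks occupy only the first \<open>M * L\<close> coordinates.\<close>
  define T where "T = Suc (M * L)"
  have pT: "p \<in> pol T" using p(1) by (rule pol_mono) (simp add: T_def)
  let ?S = "{V \<in> topspace (Euclidean_space T). p V \<noteq> 0}"
  have "malleable N T V" if V: "V \<in> ?S" for V
    unfolding malleable_def
  proof (intro conjI ballI)
    fix E assume "E \<in> topspace (Euclidean_space N) - coll N"
    then have "inj_on E {..<N}"
      unfolding coll_def by (auto intro!: linorder_inj_onI)
    \<comment> \<open>\<open>f\<close>, and with it the block \<open>n\<close>, may vary with
      \<open>E\<close>, whereas \<open>p\<close> and \<open>V\<close> are fixed before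
      \<open>E\<close>.\<close>
    from G(2)[OF this] obtain f where f: "f \<in> G" "\<exists>U. f U \<noteq> 0"
      "\<And>V. f V \<noteq> 0 \<Longrightarrow> nondeg {..<L} {..<3 * N} (sq_row E V)"
      by blast
    obtain n where n: "n < M" "f (\<lambda>l. V (n * L + l)) \<noteq> 0"
      using p(3)[OF _ f(1,2)] V by blast
    have "n * L + L = Suc n * L" by simp
    also have "\<dots> \<le> M * L" using n(1) by (intro mult_right_mono) auto
    finally have "n * L + L \<le> T" by (simp add: T_def)
    from nondeg_sq_row_shift[OF f(3)[OF n(2)] this]
    show "open_map_at (Euclidean_space T) (SL2_power N) (Phi N T E) V"
      using V by (intro nondeg_imp_open_map_at) auto
  qed (use V in auto)
  then show ?thesis
    using baire_generic_pol_nonzero[OF pT p(2)]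
    by (intro exI[of _ T] conjI exI[of _ ?S]) (auto simp: T_def)
qed

end
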